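(* Let $\tau:E\to\mathbb{R}$ be a bundle with $\dim E=n+1$, and let $R$ be a type $(1,1)$ tensor on $E$ with $R(dt)=0$, vanishing Nijenhuis torsion, and algebraically diagonalizable with distinct eigenvalues. Let $\widetilde{R}_{T^*}$ and $\widetilde{R}$ be its complete lifts to $T^*E$ and $J^1\tau^*$. Let $h$ be a section of $\rho:T^*E\to J^1\tau^*$, with associated function $\widetilde{H}$ on $T^*E$, Hamiltonian vector field $X_{\widetilde{H}}$ on $T^*E$ and Hamiltonian vector field $X_h$ on $J^1\tau^*$. Assume that the vector fields $X_{\widetilde{H}},\widetilde{R}_{T^*}(X_{\widetilde{H}}),\ldots,\widetilde{R}_{T^*}^n(X_{\widetilde{H}})$ are linearly independent, and let $$\mathcal{D}_{\widetilde{H}}=\mathrm{sp}\{X_{\widetilde{H}},\widetilde{R}_{T^*}(X_{\widetilde{H}}),\ldots,\widetilde{R}_{T^*}^n(X_{\widetilde{H}})\},\qquad \mathcal{D}_h=\mathrm{sp}\{X_h,\widetilde{R}(X_h),\ldots,\widetilde{R}^n(X_h)\}.$$ Then $\mathcal{D}_h$ is an integrable distribution on $J^1\tau^*$ if and only if $\mathcal{D}_{\widetilde{H}}$ is integrable on $T^*E$.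
   Context: All objects are smooth. $E$ has bundle coordinates $(t,q^i)$, $i=1,\ldots,n$, where $t$ is the (pulled-back) coordinate of $\mathbb{R}$. $T^*E$ has natural coordinates $(t,q^i,p_0,p_i)$, canonical 1-form $\theta_E=p_0dt+p_idq^i$ and symplectic form $\omega_E=d\theta_E$. $J^1\tau^*:=T^*E/\langle dt\rangle$, with coordinates $(t,q^i,p_i)$; $\rho:T^*E\to J^1\tau^*$ is the natural projection. A section $h$ of $\rho$ is locally $h:(t,q,p)\mapsto(t,q,p_0=-H(t,q,p),p)$, and $\widetilde{H}=p_0+H(t,q^i,p_i)$ (intrinsically, $\alpha-h(\rho(\alpha))=\widetilde{H}(\alpha)\,dt$), so that the image of $h$ is $\{\widetilde{H}=0\}$. For a function $F$ on $T^*E$, $X_F$ is defined by $i_{X_F}\omega_E=-dF$; thus $X_{\widetilde{H}}=\frac{\partial}{\partial t}+\frac{\partial H}{\partial p_i}\frac{\partial}{\partial q^i}-\frac{\partial H}{\partial q^i}\frac{\partial}{\partial p_i}-\frac{\partial H}{\partial t}\frac{\partial}{\partial p_0}$. $X_h$ on $J^1\tau^*$ is defined by $i_{X_h}h^*\omega_E=0$, $\langle X_h,dt\rangle=1$; locally $X_h=\frac{\partial}{\partial t}+\frac{\partial H}{\partial p_i}\frac{\partial}{\partial q^i}-\frac{\partial H}{\partial q^i}\frac{\partial}{\partial p_i}$. A $(1,1)$ tensor acts on vector fields and on 1-forms, with $\langle X,R(\alpha)\rangle=\langle R(X),\alpha\rangle$. If $R(dt)=0$, then $R=R^i_j(t,q)\frac{\partial}{\partial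 q^i}\otimes dq^j+R^i_0(t,q)\frac{\partial}{\partial q^i}\otimes dt$. "Algebraically diagonalizable with distinct eigenvalues" means that at each $e\in E$ the endomorphism $R_e$ of $T_eE$ is diagonalizable with $n+1$ distinct eigenvalues (one of which is $0$). $N_R(X,Y)=[RX,RY]+R^2[X,Y]-R[RX,Y]-R[X,RY]$ is the Nijenhuis torsion. $\tau_R:T^*E\to T^*E$ is $(t,q^i,p_0,p_i)\mapsto(t,q^i,R^i_0p_i,R^i_jp_i)$. The complete lift $\widetilde{R}_{T^*}$ to $T^*E$ is defined by $i_{\widetilde{R}_{T^*}(Z)}d\theta_E=i_Z(\tau_R^*d\theta_E)$ for all vector fields $Z$ on $T^*E$. The complete lift $\widetilde{R}$ to $J^1\tau^*$ is the $(1,1)$ tensor that is $\rho$-related to $\widetilde{R}_{T^*}$ (if $Y$ on $T^*E$ is $\rho$-related to $X$ on $J^1\tau^*$, then $\widetilde{R}_{T^*}(Y)$ is $\rho$-related to $\widetilde{R}(X)$); in coordinates $$\widetilde{R}=R^i_j\Big(\tfrac{\partial}{\partial q^i}\otimes dq^j+\tfrac{\partial}{\partial p_j}\otimes dp_i\Big)+R^i_0\tfrac{\partial}{\partial q^i}\otimes dt+p_i\Big(\tfrac{\partial R^i_j}{\partial q^k}-\tfrac{\partial R^i_k}{\partial q^j}\Big)\tfrac{\partial}{\partial p_j}\otimes dq^k+p_i\Big(\tfrac{\partial R^i_k}{\partial t}-\tfrac{\partial R^i_0}{\partial q^k}\Big)\tfrac{\partial}{\partial p_k}\otimes dt.$$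 It is known that $\mathcal{D}_{\widetilde{H}}$ as spanned above coincides with the annihilator of the 1-forms $d\widetilde{H},\widetilde{R}_{T^*}(d\widetilde{H}),\ldots,\widetilde{R}_{T^*}^n(d\widetilde{H})$. *)

theory Defs
  imports "HOL-Analysis.Analysis"
begin

section \<open>Smooth functions on open sets\<close>

primrec Ck_on ::
  "nat \<Rightarrow> ('a::real_normed_vector \<Rightarrow> 'b::real_normed_vector) \<Rightarrow> 'a set \<Rightarrow> bool" where
  "Ck_on 0 f S = continuous_on S f"
| "Ck_on (Suc k) f S =
     ((\<forall>x\<in>S. f differentiable (at x)) \<and> (\<forall>v. Ck_on k (\<lambda>x. frechet_derivative f (at x) v) S))"

definition smooth_on ::
  "('a::real_normed_vector \<Rightarrow> 'b::real_normed_vector) \<Rightarrow> 'a set \<Rightarrow> bool" where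
  "smooth_on f S \<longleftrightarrow> (\<forall>k. Ck_on k f S)"


section \<open>Manifolds\<close>

text \<open>
  A manifold is given by an indexed atlas.  Tangent vectors, covectors and tensors at a point are
  represented by their components in all charts around the point, subject to the usual
  transformation laws.  Covectors are paired with tangent vectors by the inner product of
  the model space, that is, \<open>\<langle>v, a\<rangle> = v i \<bullet> a i\<close> in any chart \<open>i\<close> around the point.
\<close>

record ('i, 'a, 'b) manifold =
  charts :: "'i set"
  cdom :: "'i \<Rightarrow> 'a set"
  cmap :: "'i \<Rightarrow> 'a \<Rightarrow> 'b"

definition carrier :: "('i, 'a, 'b) manifold \<Rightarrow> 'a set" where
  "carrier M = (\<Union>i\<in>charts M. cdom M i)"

definition charts_at :: "('i, 'a, 'b) manifold \<Rightarrow> 'a \<Rightarrow> 'i set" where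
  "charts_at M x = {i \<in> charts M. x \<in> cdom M i}"

definition cinv :: "('i, 'a, 'b) manifold \<Rightarrow> 'i \<Rightarrow> 'b \<Rightarrow> 'a" where
  "cinv M i = inv_into (cdom M i) (cmap M i)"

definition cimage :: "('i, 'a, 'b) manifold \<Rightarrow> 'i \<Rightarrow> 'b set" where
  "cimage M i = cmap M i ` cdom M i"

definition smooth_atlas :: "('i, 'a, 'b::euclidean_space) manifold \<Rightarrow> bool" where
  "smooth_atlas M \<longleftrightarrow>
     (\<forall>i\<in>charts M. inj_on (cmap M i) (cdom M i) \<and> open (cimage M i)) \<and>
     (\<forall>i\<in>charts M. \<forall>j\<in>charts M.
        open (cmap M i ` (cdom M i \<inter> cdom M j)) \<and>
        smooth_on (cmap M j \<circ> cinv M i) (cmap M i ` (cdom M i \<inter> cdom M j)))"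

definition atlas_open :: "('i, 'a, 'b::euclidean_space) manifold \<Rightarrow> 'a set \<Rightarrow> bool" where
  "atlas_open M U \<longleftrightarrow>
     U \<subseteq> carrier M \<and> (\<forall>i\<in>charts M. open (cmap M i ` (U \<inter> cdom M i)))"

definition atlas_topology :: "('i, 'a, 'b::euclidean_space) manifold \<Rightarrow> 'a topology" where
  "atlas_topology M = topology (atlas_open M)"

lemma openin_atlas_topology:
  assumes "smooth_atlas M"
  shows "openin (atlas_topology M) U \<longleftrightarrow> atlas_open M U"
proof -
  have inj: "inj_on (cmap M i) (cdom M i)" if "i \<in> charts M" for i
    using assms that unfolding smooth_atlas_def by blast
  have "istopology (atlas_open M)"
    unfolding istopology_def
  proof (intro conjI allI impI)
    fix S T assume S: "atlas_open M S" and T: "atlas_open M T"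
    have "open (cmap M i ` (S \<inter> T \<inter> cdom M i))" if i: "i \<in> charts M" for i
    proof -
      have "cmap M i ` (S \<inter> T \<inter> cdom M i)
          = cmap M i ` (S \<inter> cdom M i) \<inter> cmap M i ` (T \<inter> cdom M i)"
        using inj[OF i] unfolding inj_on_def by blast
      then show ?thesis
        using S T i unfolding atlas_open_def by (simp add: open_Int)
    qed
    then show "atlas_open M (S \<inter> T)"
      using S unfolding atlas_open_def by blast
  next
    fix K assume K: "\<forall>S\<in>K. atlas_open M S"
    have "open (cmap M i ` (\<Union>K \<inter> cdom M i))" if i: "i \<in> charts M" for i
    proof -
      have "cmap M i ` (\<Union>K \<inter> cdom M i) = (\<Union>S\<in>K. cmap M i ` (S \<inter> cdom M i))"
        by blast
      then show ?thesis
        using K i unfolding atlas_open_def by (simp add: open_UN)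
    qed
    then show "atlas_open M (\<Union>K)"
      using K unfolding atlas_open_def by blast
  qed
  then show ?thesis
    by (simp add: atlas_topology_def topology_inverse')
qed

definition smooth_manifold :: "('i, 'a, 'b::euclidean_space) manifold \<Rightarrow> bool" where
  "smooth_manifold M \<longleftrightarrow>
     smooth_atlas M \<and> Hausdorff_space (atlas_topology M) \<and>
     second_countable (atlas_topology M)"

definition smooth_map ::
  "('i, 'a, 'b::euclidean_space) manifold \<Rightarrow> ('j, 'c, 'd::euclidean_space) manifold \<Rightarrow>
   ('a \<Rightarrow> 'c) \<Rightarrow> bool" where
  "smooth_map M N f \<longleftrightarrow>
     f ` carrier M \<subseteq> carrier N \<and>
     (\<forall>i\<in>charts M. \<forall>j\<in>charts N.
        open (cmap M i ` {x \<in> cdom M i. f x \<in> cdom N j}) \<and>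
        smooth_on (cmap N j \<circ> f \<circ> cinv M i) (cmap M i ` {x \<in> cdom M i. f x \<in> cdom N j}))"

definition diffeomorphism ::
  "('i, 'a, 'b::euclidean_space) manifold \<Rightarrow> ('j, 'c, 'd::euclidean_space) manifold \<Rightarrow>
   ('a \<Rightarrow> 'c) \<Rightarrow> bool" where
  "diffeomorphism M N f \<longleftrightarrow>
     bij_betw f (carrier M) (carrier N) \<and> smooth_map M N f \<and>
     smooth_map N M (inv_into (carrier M) f)"

definition open_submanifold ::
  "('i, 'a, 'b) manifold \<Rightarrow> 'a set \<Rightarrow> ('i, 'a, 'b) manifold" where
  "open_submanifold M U =
     \<lparr>charts = charts M, cdom = (\<lambda>i. cdom M i \<inter> U), cmap = cmap M\<rparr>"

definition euclidean_manifold :: "'b set \<Rightarrow> (unit, 'b, 'b) manifold" where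
  "euclidean_manifold W = \<lparr>charts = UNIV, cdom = (\<lambda>_. W), cmap = (\<lambda>_ x. x)\<rparr>"

definition times_manifold ::
  "'c set \<Rightarrow> ('i, 'a, 'b) manifold \<Rightarrow> ('i, 'c \<times> 'a, 'c \<times> 'b) manifold" where
  "times_manifold I F =
     \<lparr>charts = charts F, cdom = (\<lambda>i. I \<times> cdom F i), cmap = (\<lambda>i (s, x). (s, cmap F i x))\<rparr>"


section \<open>Tensor fields\<close>

definition transition_deriv ::
  "('i, 'a, 'b::euclidean_space) manifold \<Rightarrow> 'i \<Rightarrow> 'i \<Rightarrow> 'a \<Rightarrow> 'b \<Rightarrow> 'b" where
  "transition_deriv M i j x = frechet_derivative (cmap M j \<circ> cinv M i) (at (cmap M i x))"

definition vector_field ::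
  "('i, 'a, 'b::euclidean_space) manifold \<Rightarrow> ('a \<Rightarrow> 'i \<Rightarrow> 'b) \<Rightarrow> bool" where
  "vector_field M X \<longleftrightarrow>
     (\<forall>x\<in>carrier M. \<forall>i\<in>charts_at M x. \<forall>j\<in>charts_at M x.
        X x j = transition_deriv M i j x (X x i)) \<and>
     (\<forall>i\<in>charts M. smooth_on (\<lambda>y. X (cinv M i y) i) (cimage M i))"

text \<open>Component families are normalised to be zero outside the charts around the point, so that
  each covector is represented by exactly one family.\<close>

definition cotangent_space ::
  "('i, 'a, 'b::euclidean_space) manifold \<Rightarrow> 'a \<Rightarrow> ('i \<Rightarrow> 'b) set" where
  "cotangent_space M x = {a.
     (\<forall>i\<in>charts_at M x. \<forall>j\<in>charts_at M x. \<forall>w. w \<bullet> a i = transition_deriv M i j x w \<bullet> a j) \<and>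
     (\<forall>i. i \<notin> charts_at M x \<longrightarrow> a i = 0)}"

definition tensor11 ::
  "('i, 'a, 'b::euclidean_space) manifold \<Rightarrow> ('a \<Rightarrow> 'i \<Rightarrow> 'b \<Rightarrow> 'b) \<Rightarrow> bool" where
  "tensor11 M R \<longleftrightarrow>
     (\<forall>x\<in>carrier M. \<forall>i\<in>charts_at M x. linear (R x i)) \<and>
     (\<forall>x\<in>carrier M. \<forall>i\<in>charts_at M x. \<forall>j\<in>charts_at M x. \<forall>w.
        R x j (transition_deriv M i j x w) = transition_deriv M i j x (R x i w)) \<and>
     (\<forall>i\<in>charts M. \<forall>w. smooth_on (\<lambda>y. R (cinv M i y) i w) (cimage M i))"

definition tensor_vec ::
  "('a \<Rightarrow> 'i \<Rightarrow> 'b \<Rightarrow> 'b) \<Rightarrow> ('a \<Rightarrow> 'i \<Rightarrow> 'b) \<Rightarrow> 'a \<Rightarrow> 'i \<Rightarrow> 'b" where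
  "tensor_vec R X = (\<lambda>x i. R x i (X x i))"

text \<open>The action on covectors, \<open>\<langle>v, R a\<rangle> = \<langle>R v, a\<rangle>\<close>.\<close>

definition tensor_covec ::
  "('i, 'a, 'b::euclidean_space) manifold \<Rightarrow> ('a \<Rightarrow> 'i \<Rightarrow> 'b \<Rightarrow> 'b) \<Rightarrow> 'a \<Rightarrow> ('i \<Rightarrow> 'b) \<Rightarrow> 'i \<Rightarrow> 'b" where
  "tensor_covec M R x a = (\<lambda>i. if i \<in> charts_at M x then adjoint (R x i) (a i) else 0)"

definition differential ::
  "('i, 'a, 'b::euclidean_space) manifold \<Rightarrow> ('a \<Rightarrow> real) \<Rightarrow> 'a \<Rightarrow> 'i \<Rightarrow> 'b" where
  "differential M F x i =
     (if i \<in> charts_at M x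
      then \<Sum>b\<in>Basis. frechet_derivative (F \<circ> cinv M i) (at (cmap M i x)) b *\<^sub>R b else 0)"

text \<open>\<open>d\<alpha>(u, v) = u(\<alpha>(v)) - v(\<alpha>(u))\<close> for constant \<open>u\<close>, \<open>v\<close> in a chart.\<close>

definition ext_deriv ::
  "('i, 'a, 'b::euclidean_space) manifold \<Rightarrow> ('a \<Rightarrow> 'i \<Rightarrow> 'b) \<Rightarrow> 'a \<Rightarrow> 'i \<Rightarrow> 'b \<Rightarrow> 'b \<Rightarrow> real" where
  "ext_deriv M \<alpha> x i u v =
     frechet_derivative (\<lambda>y. v \<bullet> \<alpha> (cinv M i y) i) (at (cmap M i x)) u -
     frechet_derivative (\<lambda>y. u \<bullet> \<alpha> (cinv M i y) i) (at (cmap M i x)) v"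

definition lie_bracket ::
  "('i, 'a, 'b::euclidean_space) manifold \<Rightarrow> ('a \<Rightarrow> 'i \<Rightarrow> 'b) \<Rightarrow> ('a \<Rightarrow> 'i \<Rightarrow> 'b) \<Rightarrow> 'a \<Rightarrow> 'i \<Rightarrow> 'b" where
  "lie_bracket M X Y x i =
     frechet_derivative (\<lambda>y. Y (cinv M i y) i) (at (cmap M i x)) (X x i) -
     frechet_derivative (\<lambda>y. X (cinv M i y) i) (at (cmap M i x)) (Y x i)"

definition nijenhuis_torsion ::
  "('i, 'a, 'b::euclidean_space) manifold \<Rightarrow> ('a \<Rightarrow> 'i \<Rightarrow> 'b \<Rightarrow> 'b) \<Rightarrow>
   ('a \<Rightarrow> 'i \<Rightarrow> 'b) \<Rightarrow> ('a \<Rightarrow> 'i \<Rightarrow> 'b) \<Rightarrow> 'a \<Rightarrow> 'i \<Rightarrow> 'b" where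
  "nijenhuis_torsion M R X Y x i =
     lie_bracket M (tensor_vec R X) (tensor_vec R Y) x i
     + R x i (R x i (lie_bracket M X Y x i))
     - R x i (lie_bracket M (tensor_vec R X) Y x i)
     - R x i (lie_bracket M X (tensor_vec R Y) x i)"

definition nijenhuis_torsion_free ::
  "('i, 'a, 'b::euclidean_space) manifold \<Rightarrow> ('a \<Rightarrow> 'i \<Rightarrow> 'b \<Rightarrow> 'b) \<Rightarrow> bool" where
  "nijenhuis_torsion_free M R \<longleftrightarrow>
     (\<forall>X Y. vector_field M X \<and> vector_field M Y \<longrightarrow>
        (\<forall>x\<in>carrier M. \<forall>i\<in>charts_at M x. nijenhuis_torsion M R X Y x i = 0))"

definition diagonalizable_distinct ::
  "('i, 'a, 'b::euclidean_space) manifold \<Rightarrow> ('a \<Rightarrow> 'i \<Rightarrow> 'b \<Rightarrow> 'b) \<Rightarrow> bool" where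
  "diagonalizable_distinct M R \<longleftrightarrow>
     (\<forall>x\<in>carrier M. \<forall>i\<in>charts_at M x.
        (\<exists>B. independent B \<and> span B = UNIV \<and> (\<forall>b\<in>B. \<exists>l. R x i b = l *\<^sub>R b)) \<and>
        card {l. \<exists>v. v \<noteq> 0 \<and> R x i v = l *\<^sub>R v} = DIM('b))"

text \<open>
  \<open>E\<close>, \<open>T\<^sup>*E\<close> and \<open>J\<^sup>1\<tau>\<^sup>*\<close> are given below by atlases with the same index set, where
  the charts with index \<open>i\<close> lie over the same domain in \<open>E\<close>.  All maps to which the following
  three definitions are applied cover the identity of \<open>E\<close>, and hence map the domain of chart \<open>i\<close>
  into the domain of chart \<open>i\<close>.
\<close>

definition tangent_map ::
  "('i, 'a, 'b::euclidean_space) manifold \<Rightarrow> ('i, 'c, 'd::euclidean_space) manifold \<Rightarrow>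
   ('a \<Rightarrow> 'c) \<Rightarrow> 'a \<Rightarrow> 'i \<Rightarrow> 'b \<Rightarrow> 'd" where
  "tangent_map M N f x i = frechet_derivative (cmap N i \<circ> f \<circ> cinv M i) (at (cmap M i x))"

definition pullback2 ::
  "('i, 'a, 'b::euclidean_space) manifold \<Rightarrow> ('i, 'c, 'd::euclidean_space) manifold \<Rightarrow>
   ('a \<Rightarrow> 'c) \<Rightarrow> ('c \<Rightarrow> 'i \<Rightarrow> 'd \<Rightarrow> 'd \<Rightarrow> real) \<Rightarrow> 'a \<Rightarrow> 'i \<Rightarrow> 'b \<Rightarrow> 'b \<Rightarrow> real" where
  "pullback2 M N f \<omega> x i u v = \<omega> (f x) i (tangent_map M N f x i u) (tangent_map M N f x i v)"

definition related ::
  "('i, 'a, 'b::euclidean_space) manifold \<Rightarrow> ('i, 'c, 'd::euclidean_space) manifold \<Rightarrow>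
   ('a \<Rightarrow> 'c) \<Rightarrow> ('a \<Rightarrow> 'i \<Rightarrow> 'b) \<Rightarrow> ('c \<Rightarrow> 'i \<Rightarrow> 'd) \<Rightarrow> bool" where
  "related M N f Y X \<longleftrightarrow>
     (\<forall>x\<in>carrier M. \<forall>i\<in>charts_at M x. tangent_map M N f x i (Y x i) = X (f x) i)"


section \<open>Distributions\<close>

definition krylov_distribution ::
  "nat \<Rightarrow> ('a \<Rightarrow> 'i \<Rightarrow> 'b \<Rightarrow> 'b) \<Rightarrow> ('a \<Rightarrow> 'i \<Rightarrow> 'b) \<Rightarrow> 'a \<Rightarrow> 'i \<Rightarrow> 'b::euclidean_space set" where
  "krylov_distribution n R X x i = span {((tensor_vec R ^^ k) X) x i |k. k \<le> n}"

text \<open>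
  Through every point there passes an integral manifold, that is, an immersed submanifold whose
  tangent spaces are the subspaces of the distribution.  Immersed submanifolds are the images of
  injective immersions; an integral manifold through \<open>x\<close> may be shrunk to the domain of one of its
  charts, so it is parametrised by an open set \<open>W\<close> of a Euclidean space \<open>'k\<close>, whose dimension is
  the rank of the distribution.
\<close>

definition integrable_distribution ::
  "'k::euclidean_space itself \<Rightarrow> ('i, 'a, 'b::euclidean_space) manifold \<Rightarrow>
   ('a \<Rightarrow> 'i \<Rightarrow> 'b set) \<Rightarrow> bool" where
  "integrable_distribution _ M D \<longleftrightarrow>
     (\<forall>x\<in>carrier M. \<exists>(W :: 'k set) f.
        open W \<and> inj_on f W \<and> x \<in> f ` W \<and> smooth_map (euclidean_manifold W) M f \<and>
        (\<forall>w\<in>W. \<forall>i\<in>charts_at M (f w).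
           inj (frechet_derivative (cmap M i \<circ> f) (at w)) \<and>
           range (frechet_derivative (cmap M i \<circ> f) (at w)) = D (f w) i))"


section \<open>Bundles over the real line\<close>

text \<open>The atlas of the total space consists of bundle charts \<open>(t, q)\<close>, where \<open>t\<close> is the pullback
  of the coordinate of the base.  \<open>F\<close> is the typical fibre.\<close>

definition bundle_over_real ::
  "('i, 'e, real \<times> (real ^ 'n)) manifold \<Rightarrow> ('e \<Rightarrow> real) \<Rightarrow> bool" where
  "bundle_over_real E \<tau> \<longleftrightarrow>
     smooth_manifold E \<and> \<tau> ` carrier E = UNIV \<and>
     (\<forall>i\<in>charts E. \<forall>e\<in>cdom E i. fst (cmap E i e) = \<tau> e) \<and>
     (\<exists>F :: ('i, 'e, real ^ 'n) manifold. smooth_manifold F \<and>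
        (\<forall>t. \<exists>I \<psi>. open I \<and> t \<in> I \<and>
           diffeomorphism (open_submanifold E (\<tau> -` I)) (times_manifold I F) \<psi> \<and>
           (\<forall>e\<in>carrier E. \<tau> e \<in> I \<longrightarrow> fst (\<psi> e) = \<tau> e)))"

type_synonym ('i, 'e, 'b) covector = "'e \<times> ('i \<Rightarrow> 'b)"

text \<open>Charts \<open>((t, q), (p\<^sub>0, p))\<close>.\<close>

definition cotangent_bundle ::
  "('i, 'e, 'b::euclidean_space) manifold \<Rightarrow> ('i, ('i, 'e, 'b) covector, 'b \<times> 'b) manifold" where
  "cotangent_bundle E =
     \<lparr>charts = charts E,
      cdom = (\<lambda>i. {(e, a). e \<in> cdom E i \<and> a \<in> cotangent_space E e}),
      cmap = (\<lambda>i (e, a). (cmap E i e, a i))\<rparr>"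

text \<open>The projection to the quotient by the span of \<open>dt\<close>; the points of the quotient are
  the cosets.\<close>

definition rho ::
  "('i, 'e, 'b::euclidean_space) manifold \<Rightarrow> ('e \<Rightarrow> real) \<Rightarrow>
   ('i, 'e, 'b) covector \<Rightarrow> ('i, 'e, 'b) covector set" where
  "rho E \<tau> z = {(fst z, \<lambda>i. snd z i + s *\<^sub>R differential E \<tau> (fst z) i) |s. True}"

text \<open>Charts \<open>((t, q), p)\<close>.  In a bundle chart \<open>dt\<close> has components \<open>(1, 0)\<close>, so the value does
  not depend on the representative of the coset.\<close>

definition dual_jet_bundle ::
  "('i, 'e, real \<times> (real ^ 'n)) manifold \<Rightarrow> ('e \<Rightarrow> real) \<Rightarrow>
   ('i, ('i, 'e, real \<times> (real ^ 'n)) covector set, (real \<times> (real ^ 'n)) \<times> (real ^ 'n)) manifold"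
where
  "dual_jet_bundle E \<tau> =
     \<lparr>charts = charts E,
      cdom = (\<lambda>i. rho E \<tau> ` cdom (cotangent_bundle E) i),
      cmap = (\<lambda>i S. let (e, a) = SOME z. z \<in> S in (cmap E i e, snd (a i)))\<rparr>"

definition dual_jet_time ::
  "('e \<Rightarrow> real) \<Rightarrow> ('i, 'e, 'b) covector set \<Rightarrow> real" where
  "dual_jet_time \<tau> S = \<tau> (fst (SOME z. z \<in> S))"

text \<open>The canonical 1-form \<open>p\<^sub>0 dt + p\<^sub>i dq\<^sup>i\<close>.\<close>

definition canonical_form :: "('i, 'e, 'b) covector \<Rightarrow> 'i \<Rightarrow> 'b \<times> 'b::euclidean_space" where
  "canonical_form z i = (snd z i, 0)"

definition canonical_symplectic ::
  "('i, 'e, 'b::euclidean_space) manifold \<Rightarrow>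
   ('i, 'e, 'b) covector \<Rightarrow> 'i \<Rightarrow> 'b \<times> 'b \<Rightarrow> 'b \<times> 'b \<Rightarrow> real" where
  "canonical_symplectic E = ext_deriv (cotangent_bundle E) canonical_form"


section \<open>Complete lifts\<close>

definition tau_map ::
  "('i, 'e, 'b::euclidean_space) manifold \<Rightarrow> ('e \<Rightarrow> 'i \<Rightarrow> 'b \<Rightarrow> 'b) \<Rightarrow>
   ('i, 'e, 'b) covector \<Rightarrow> ('i, 'e, 'b) covector" where
  "tau_map E R z = (fst z, tensor_covec E R (fst z) (snd z))"

definition complete_lift_cotangent ::
  "('i, 'e, 'b::euclidean_space) manifold \<Rightarrow> ('e \<Rightarrow> 'i \<Rightarrow> 'b \<Rightarrow> 'b) \<Rightarrow>
   (('i, 'e, 'b) covector \<Rightarrow> 'i \<Rightarrow> 'b \<times> 'b \<Rightarrow> 'b \<times> 'b) \<Rightarrow> bool" where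
  "complete_lift_cotangent E R RT \<longleftrightarrow>
     tensor11 (cotangent_bundle E) RT \<and>
     (\<forall>Z. vector_field (cotangent_bundle E) Z \<longrightarrow>
        (\<forall>z\<in>carrier (cotangent_bundle E). \<forall>i\<in>charts_at (cotangent_bundle E) z. \<forall>w.
           canonical_symplectic E z i (tensor_vec RT Z z i) w =
           pullback2 (cotangent_bundle E) (cotangent_bundle E) (tau_map E R)
             (canonical_symplectic E) z i (Z z i) w))"

definition complete_lift_dual_jet ::
  "('i, 'e, real \<times> (real ^ 'n)) manifold \<Rightarrow> ('e \<Rightarrow> real) \<Rightarrow>
   (('i, 'e, real \<times> (real ^ 'n)) covector \<Rightarrow> 'i \<Rightarrow>
      (real \<times> (real ^ 'n)) \<times> (real \<times> (real ^ 'n)) \<Rightarrow>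
      (real \<times> (real ^ 'n)) \<times> (real \<times> (real ^ 'n))) \<Rightarrow>
   (('i, 'e, real \<times> (real ^ 'n)) covector set \<Rightarrow> 'i \<Rightarrow>
      (real \<times> (real ^ 'n)) \<times> (real ^ 'n) \<Rightarrow> (real \<times> (real ^ 'n)) \<times> (real ^ 'n)) \<Rightarrow> bool" where
  "complete_lift_dual_jet E \<tau> RT RJ \<longleftrightarrow>
     tensor11 (dual_jet_bundle E \<tau>) RJ \<and>
     (\<forall>Y X. vector_field (cotangent_bundle E) Y \<and> vector_field (dual_jet_bundle E \<tau>) X \<and>
        related (cotangent_bundle E) (dual_jet_bundle E \<tau>) (rho E \<tau>) Y X \<longrightarrow>
        related (cotangent_bundle E) (dual_jet_bundle E \<tau>) (rho E \<tau>)
          (tensor_vec RT Y) (tensor_vec RJ X))"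


section \<open>Hamiltonian sections\<close>

definition hamiltonian_section ::
  "('i, 'e, real \<times> (real ^ 'n)) manifold \<Rightarrow> ('e \<Rightarrow> real) \<Rightarrow>
   (('i, 'e, real \<times> (real ^ 'n)) covector set \<Rightarrow> ('i, 'e, real \<times> (real ^ 'n)) covector) \<Rightarrow>
   bool" where
  "hamiltonian_section E \<tau> h \<longleftrightarrow>
     smooth_map (dual_jet_bundle E \<tau>) (cotangent_bundle E) h \<and>
     (\<forall>x\<in>carrier (dual_jet_bundle E \<tau>). rho E \<tau> (h x) = x)"

text \<open>The function \<open>z - h (\<rho> z) = H dt\<close>.\<close>

definition section_function ::
  "('i, 'e, real \<times> (real ^ 'n)) manifold \<Rightarrow> ('e \<Rightarrow> real) \<Rightarrow>
   (('i, 'e, real \<times> (real ^ 'n)) covector set \<Rightarrow> ('i, 'e, real \<times> (real ^ 'n)) covector) \<Rightarrow>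
   ('i, 'e, real \<times> (real ^ 'n)) covector \<Rightarrow> real" where
  "section_function E \<tau> h z =
     (THE s. \<forall>i\<in>charts_at E (fst z).
        snd z i - snd (h (rho E \<tau> z)) i = s *\<^sub>R differential E \<tau> (fst z) i)"

definition hamiltonian_field_cotangent ::
  "('i, 'e, 'b::euclidean_space) manifold \<Rightarrow> (('i, 'e, 'b) covector \<Rightarrow> real) \<Rightarrow>
   (('i, 'e, 'b) covector \<Rightarrow> 'i \<Rightarrow> 'b \<times> 'b) \<Rightarrow> bool" where
  "hamiltonian_field_cotangent E G X \<longleftrightarrow>
     vector_field (cotangent_bundle E) X \<and>
     (\<forall>z\<in>carrier (cotangent_bundle E). \<forall>i\<in>charts_at (cotangent_bundle E) z. \<forall>w.
        canonical_symplectic E z i (X z i) w = - (w \<bullet> differential (cotangent_bundle E) G z i))"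

definition hamiltonian_field_dual_jet ::
  "('i, 'e, real \<times> (real ^ 'n)) manifold \<Rightarrow> ('e \<Rightarrow> real) \<Rightarrow>
   (('i, 'e, real \<times> (real ^ 'n)) covector set \<Rightarrow> ('i, 'e, real \<times> (real ^ 'n)) covector) \<Rightarrow>
   (('i, 'e, real \<times> (real ^ 'n)) covector set \<Rightarrow> 'i \<Rightarrow> (real \<times> (real ^ 'n)) \<times> (real ^ 'n)) \<Rightarrow>
   bool" where
  "hamiltonian_field_dual_jet E \<tau> h X \<longleftrightarrow>
     vector_field (dual_jet_bundle E \<tau>) X \<and>
     (\<forall>x\<in>carrier (dual_jet_bundle E \<tau>). \<forall>i\<in>charts_at (dual_jet_bundle E \<tau>) x.
        (\<forall>w. pullback2 (dual_jet_bundle E \<tau>) (cotangent_bundle E) h (canonical_symplectic E)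
               x i (X x i) w = 0) \<and>
        X x i \<bullet> differential (dual_jet_bundle E \<tau>) (dual_jet_time \<tau>) x i = 1)"

end

theory Submission
  imports Defs
begin

text \<open>
  Write \<open>Y\<^sub>k\<close> for the \<open>k\<close>-th power of the lift applied to \<open>X\<^bsub>H\<^esub>\<close>.
  The lift to \<open>T\<^sup>*E\<close> is symmetric for the symplectic form \<open>\<omega>\<close>, so \<open>\<omega>(Y\<^sub>k, X\<^bsub>H\<^esub>) = 0\<close> and
  all \<open>Y\<^sub>k\<close> are tangent to the level sets of the section function.  These level sets are the
  translates \<open>h + c dt\<close> of the image of \<open>h\<close>, and \<open>\<rho>\<close> maps each of them diffeomorphically to the
  dual jet bundle.  Since \<open>X\<^bsub>H\<^esub>\<close> and \<open>X\<^sub>h\<close> are \<open>\<rho>\<close>-related, so are their images under powers of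
  the lifts, whence at every point the upper distribution is the image of the lower one under the
  derivative of \<open>h\<close> (in bundle charts, where translation acts trivially on vectors).
  An integral manifold \<open>f\<close> below thus gives the integral manifold \<open>h \<circ> f + c dt\<close> above; conversely,
  the section function is constant along a connected integral manifold above, which \<open>\<rho>\<close> therefore
  maps injectively to an integral manifold below.
\<close>

section \<open>Calculus of smooth functions\<close>

lemma has_derivative_cong_open:
  assumes "open S" "x \<in> S" "\<And>y. y \<in> S \<Longrightarrow> f y = g y"
  shows "(f has_derivative D) (at x) \<longleftrightarrow> (g has_derivative D) (at x)"
  using has_derivative_transform_within_open[OF _ assms(1,2), of f D UNIV g]
    has_derivative_transform_within_open[OF _ assms(1,2), of g D UNIV f] assms(3) by auto

lemma frechet_derivative_cong_open:
  assumes "open S" "x \<in> S" "\<And>y. y \<in> S \<Longrightarrow> f y = g y"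
  shows "frechet_derivative f (at x) = frechet_derivative g (at x)"
  unfolding frechet_derivative_def by (simp only: has_derivative_cong_open[OF assms])

lemma differentiable_cong_open:
  assumes "open S" "x \<in> S" "\<And>y. y \<in> S \<Longrightarrow> f y = g y"
  shows "f differentiable (at x) \<longleftrightarrow> g differentiable (at x)"
  unfolding differentiable_def by (simp only: has_derivative_cong_open[OF assms])

lemma Ck_on_cong:
  assumes "open S" "\<And>x. x \<in> S \<Longrightarrow> f x = g x"
  shows "Ck_on k f S \<longleftrightarrow> Ck_on k g S"
  using assms(2)
proof (induction k arbitrary: f g)
  case 0
  then show ?case by (simp cong: continuous_on_cong)
next
  case (Suc k)
  have "f differentiable (at x) \<longleftrightarrow> g differentiable (at x)" if "x \<in> S" for x
    using differentiable_cong_open[OF assms(1) that] Suc.prems by blast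
  moreover have "Ck_on k (\<lambda>x. frechet_derivative f (at x) v) S
      \<longleftrightarrow> Ck_on k (\<lambda>x. frechet_derivative g (at x) v) S" for v
  proof (rule Suc.IH)
    show "frechet_derivative f (at x) v = frechet_derivative g (at x) v" if "x \<in> S" for x
      by (simp only: frechet_derivative_cong_open[OF assms(1) that Suc.prems])
  qed
  ultimately show ?case by simp
qed

lemma Ck_on_subset: "Ck_on k f S \<Longrightarrow> T \<subseteq> S \<Longrightarrow> Ck_on k f T"
  by (induction k arbitrary: f) (auto intro: continuous_on_subset)

text \<open>In the product and chain rules an undifferentiated map stands next to a derivative, so
  it has to be available at the lower order as well.\<close>

lemma Ck_on_Suc_imp_Ck_on: "Ck_on (Suc k) f S \<Longrightarrow> Ck_on k f S"
proof (induction k arbitrary: f)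
  case 0
  then have "f differentiable_on S"
    by (simp add: differentiable_at_imp_differentiable_on)
  then show ?case
    by (simp add: differentiable_imp_continuous_on)
next
  case (Suc k)
  note f = Suc.prems[unfolded Ck_on.simps(2)[of "Suc k"]]
  have "Ck_on k (\<lambda>x. frechet_derivative f (at x) v) S" for v
    by (rule Suc.IH[OF f[THEN conjunct2, THEN spec]])
  then show ?case
    using f[THEN conjunct1] unfolding Ck_on.simps by blast
qed

text \<open>Any derivative obtained from a rule may replace \<open>frechet_derivative\<close>:
  uniqueness identifies the two on \<open>S\<close>, and openness of \<open>S\<close> carries the
  identification to all further derivatives.\<close>

lemma Ck_on_SucI:
  assumes "open S" "\<And>x. x \<in> S \<Longrightarrow> (f has_derivative D x) (at x)"
    "\<And>v. Ck_on k (\<lambda>x. D x v) S"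
  shows "Ck_on (Suc k) f S"
proof -
  have "Ck_on k (\<lambda>x. frechet_derivative f (at x) v) S" for v
  proof -
    have "D x v = frechet_derivative f (at x) v" if "x \<in> S" for x
      using fun_cong[OF frechet_derivative_at[OF assms(2)[OF that]]] .
    then have "Ck_on k (\<lambda>x. D x v) S \<longleftrightarrow> Ck_on k (\<lambda>x. frechet_derivative f (at x) v) S"
      by (rule Ck_on_cong[OF assms(1)])
    then show ?thesis using assms(3) by blast
  qed
  then show ?thesis using assms(2) unfolding Ck_on.simps differentiable_def by blast
qed

lemma Ck_on_SucD:
  assumes "Ck_on (Suc k) f S"
  shows "x \<in> S \<Longrightarrow> (f has_derivative frechet_derivative f (at x)) (at x)"
    and "Ck_on k (\<lambda>x. frechet_derivative f (at x) v) S"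
  using assms by (simp_all add: frechet_derivative_works)

lemma Ck_on_const: "open S \<Longrightarrow> Ck_on k (\<lambda>x. c) S"
  by (induction k arbitrary: c) (simp, rule Ck_on_SucI[where D = "\<lambda>x v. 0"], auto)

lemma Ck_on_bounded_linear:
  assumes "open S" "bounded_linear L" "Ck_on k f S"
  shows "Ck_on k (\<lambda>x. L (f x)) S"
  using assms(3)
proof (induction k arbitrary: f)
  case 0
  then show ?case by (simp add: bounded_linear.continuous_on[OF assms(2)])
next
  case (Suc k)
  note f = Ck_on_SucD[OF Suc.prems]
  show ?case
    by (rule Ck_on_SucI[OF assms(1) bounded_linear.has_derivative[OF assms(2) f(1)] Suc.IH[OF f(2)]])
qed

lemma Ck_on_add:
  assumes "open S" "Ck_on k f S" "Ck_on k g S"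
  shows "Ck_on k (\<lambda>x. f x + g x) S"
  using assms(2,3)
proof (induction k arbitrary: f g)
  case 0
  then show ?case by (simp add: continuous_on_add)
next
  case (Suc k)
  note f = Ck_on_SucD[OF Suc.prems(1)] and g = Ck_on_SucD[OF Suc.prems(2)]
  show ?case
    by (rule Ck_on_SucI[OF assms(1) has_derivative_add[OF f(1) g(1)] Suc.IH[OF f(2) g(2)]])
qed

lemma Ck_on_sum:
  assumes "open S" "\<And>a. a \<in> A \<Longrightarrow> Ck_on k (f a) S"
  shows "Ck_on k (\<lambda>x. \<Sum>a\<in>A. f a x) S"
  using assms(2)
proof (induction A rule: infinite_finite_induct)
  case (insert a A)
  then show ?case using Ck_on_add[OF assms(1), of k "f a" "\<lambda>x. \<Sum>a\<in>A. f a x"] by simp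
qed (simp_all add: Ck_on_const assms(1))

lemma Ck_on_scaleR:
  assumes "open S" "Ck_on k c S" "Ck_on k f S"
  shows "Ck_on k (\<lambda>x. c x *\<^sub>R f x) S"
  using assms(2,3)
proof (induction k arbitrary: c f)
  case 0
  then show ?case by (simp add: continuous_on_scaleR)
next
  case (Suc k)
  note c = Ck_on_SucD[OF Suc.prems(1)] and f = Ck_on_SucD[OF Suc.prems(2)]
  show ?case
    using Suc.prems[THEN Ck_on_Suc_imp_Ck_on]
    by (intro Ck_on_SucI[OF assms(1) has_derivative_scaleR[OF c(1) f(1)]]
        Ck_on_add[OF assms(1)] Suc.IH c(2) f(2))
qed

lemma Ck_on_compose:
  fixes f :: "'a::real_normed_vector \<Rightarrow> 'b::euclidean_space" and g :: "'b \<Rightarrow> 'c::real_normed_vector"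
  assumes "open S" "f ` S \<subseteq> T" "Ck_on k f S" "Ck_on k g T"
  shows "Ck_on k (\<lambda>x. g (f x)) S"
  using assms(3,4)
proof (induction k arbitrary: g)
  case 0
  then show ?case using assms(2) by (auto intro: continuous_on_compose2)
next
  case (Suc k)
  note f = Ck_on_SucD[OF Suc.prems(1)] and g = Ck_on_SucD[OF Suc.prems(2)]
  show ?case
  proof (rule Ck_on_SucI[OF assms(1)])
    fix x assume x: "x \<in> S"
    then have fx: "f x \<in> T" using assms(2) by blast
    \<comment> \<open>The direction \<open>d v\<close> will vary with the base point, whereas
      \<open>Ck_on\<close> controls the derivative of \<open>g\<close> in fixed directions. The
      basis expansion reduces to fixed directions, with coefficients from the derivative of
      \<open>f\<close>.\<close>
    have eq: "(\<lambda>v. frechet_derivative g (at (f x)) (d v)) =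
        (\<lambda>v. \<Sum>b\<in>Basis. (d v \<bullet> b) *\<^sub>R frechet_derivative g (at (f x)) b)" for d :: "'a \<Rightarrow> 'b"
    proof
      fix v
      have "frechet_derivative g (at (f x)) (\<Sum>b\<in>Basis. (d v \<bullet> b) *\<^sub>R b) =
          (\<Sum>b\<in>Basis. (d v \<bullet> b) *\<^sub>R frechet_derivative g (at (f x)) b)"
        using has_derivative_linear[OF g(1)[OF fx]] by (simp add: linear_sum linear_scale)
      then show "frechet_derivative g (at (f x)) (d v) =
          (\<Sum>b\<in>Basis. (d v \<bullet> b) *\<^sub>R frechet_derivative g (at (f x)) b)"
        unfolding euclidean_representation .
    qed
    from has_derivative_compose[OF f(1)[OF x] g(1)[OF fx], unfolded eq]
    show "((\<lambda>x. g (f x)) has_derivative (\<lambda>v. \<Sum>b\<in>Basis. (frechet_derivative f (at x) v \<bullet> b)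
        *\<^sub>R frechet_derivative g (at (f x)) b)) (at x)" .
  next
    show "Ck_on k (\<lambda>x. \<Sum>b\<in>Basis. (frechet_derivative f (at x) v \<bullet> b)
        *\<^sub>R frechet_derivative g (at (f x)) b) S" for v
      by (intro Ck_on_sum Ck_on_scaleR Ck_on_bounded_linear[OF _ bounded_linear_inner_left]
          assms(1) f(2) Suc.IH Ck_on_Suc_imp_Ck_on[OF Suc.prems(1)] g(2))
  qed
qed

lemma smooth_on_cong: "open S \<Longrightarrow> (\<And>x. x \<in> S \<Longrightarrow> f x = g x) \<Longrightarrow> smooth_on f S \<longleftrightarrow> smooth_on g S"
  by (simp add: smooth_on_def Ck_on_cong[of S f g])

lemma smooth_on_transform:
  "smooth_on g S \<Longrightarrow> open S \<Longrightarrow> (\<And>x. x \<in> S \<Longrightarrow> f x = g x) \<Longrightarrow> smooth_on f S"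
  by (simp add: smooth_on_cong[of S f g])

lemma smooth_on_subset: "smooth_on f S \<Longrightarrow> T \<subseteq> S \<Longrightarrow> smooth_on f T"
  unfolding smooth_on_def using Ck_on_subset by blast

lemma smooth_on_bounded_linear:
  "open S \<Longrightarrow> bounded_linear L \<Longrightarrow> smooth_on f S \<Longrightarrow> smooth_on (\<lambda>x. L (f x)) S"
  by (simp add: smooth_on_def Ck_on_bounded_linear)

lemma smooth_on_add_const: "open S \<Longrightarrow> smooth_on f S \<Longrightarrow> smooth_on (\<lambda>x. f x + c) S"
  by (simp add: smooth_on_def Ck_on_add Ck_on_const)

lemma smooth_on_compose:
  fixes f :: "'a::real_normed_vector \<Rightarrow> 'b::euclidean_space" and g :: "'b \<Rightarrow> 'c::real_normed_vector"
  assumes "open S" "f ` S \<subseteq> T" "smooth_on f S" "smooth_on g T"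
  shows "smooth_on (\<lambda>x. g (f x)) S"
  using assms by (simp add: smooth_on_def Ck_on_compose)

lemma smooth_on_imp_differentiable: "smooth_on f S \<Longrightarrow> x \<in> S \<Longrightarrow> f differentiable (at x)"
  unfolding smooth_on_def by (metis Ck_on.simps(2))

text \<open>\<open>tensor11\<close> speaks of smoothness on constant vectors, so the varying vector
  is expanded in the basis and each summand becomes a product of smooth maps. Openness of the chart
  images is assumed directly, since for both bundles it is read off from an explicit description of
  these images.\<close>

lemma vector_field_tensor_vec:
  assumes R: "tensor11 M R" and X: "vector_field M X"
    and op: "\<And>i. i \<in> charts M \<Longrightarrow> open (cimage M i)"
  shows "vector_field M (tensor_vec R X)"
  unfolding vector_field_def
proof (intro conjI ballI)
  fix x i j assume "x \<in> carrier M" "i \<in> charts_at M x" "j \<in> charts_at M x"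
  then show "tensor_vec R X x j = transition_deriv M i j x (tensor_vec R X x i)"
    using R X unfolding tensor11_def vector_field_def tensor_vec_def by metis
next
  fix i assume i: "i \<in> charts M"
  have eq: "(\<Sum>b\<in>Basis. (X (cinv M i y) i \<bullet> b) *\<^sub>R R (cinv M i y) i b) = tensor_vec R X (cinv M i y) i"
    if "y \<in> cimage M i" for y
  proof -
    have "cinv M i y \<in> cdom M i"
      using that unfolding cinv_def cimage_def by (simp add: inv_into_into)
    then have "linear (R (cinv M i y) i)"
      using R i unfolding tensor11_def carrier_def charts_at_def by blast
    then have "R (cinv M i y) i (\<Sum>b\<in>Basis. (X (cinv M i y) i \<bullet> b) *\<^sub>R b) =
        (\<Sum>b\<in>Basis. (X (cinv M i y) i \<bullet> b) *\<^sub>R R (cinv M i y) i b)"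
      by (simp add: linear_sum linear_scale)
    then show ?thesis
      unfolding tensor_vec_def euclidean_representation by simp
  qed
  have "Ck_on k (\<lambda>y. \<Sum>b\<in>Basis. (X (cinv M i y) i \<bullet> b) *\<^sub>R R (cinv M i y) i b) (cimage M i)" for k
  proof (intro Ck_on_sum Ck_on_scaleR Ck_on_bounded_linear[OF _ bounded_linear_inner_left] op[OF i])
    show "Ck_on k (\<lambda>y. X (cinv M i y) i) (cimage M i)"
      using X i unfolding vector_field_def smooth_on_def by blast
    show "Ck_on k (\<lambda>y. R (cinv M i y) i b) (cimage M i)" for b
      using R i unfolding tensor11_def smooth_on_def by blast
  qed
  then show "smooth_on (\<lambda>y. tensor_vec R X (cinv M i y) i) (cimage M i)"
    by (subst smooth_on_cong[OF op[OF i] eq[symmetric]]) (simp_all add: smooth_on_def)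
qed

section \<open>Charts of the cotangent bundle\<close>

lemma cinv_in_cdom: "y \<in> cimage M i \<Longrightarrow> cinv M i y \<in> cdom M i"
  unfolding cinv_def cimage_def by (rule inv_into_into)

lemma cmap_cinv: "y \<in> cimage M i \<Longrightarrow> cmap M i (cinv M i y) = y"
  unfolding cinv_def cimage_def by (rule f_inv_into_f)

lemma cmap_in_cimage: "x \<in> cdom M i \<Longrightarrow> cmap M i x \<in> cimage M i"
  unfolding cimage_def by blast

lemma charts_at_iff: "i \<in> charts_at M x \<longleftrightarrow> i \<in> charts M \<and> x \<in> cdom M i"
  by (simp add: charts_at_def)

lemma cdom_subset_carrier: "i \<in> charts M \<Longrightarrow> x \<in> cdom M i \<Longrightarrow> x \<in> carrier M"
  by (auto simp: carrier_def)

lemma charts_at_nonempty: "x \<in> carrier M \<Longrightarrow> \<exists>i. i \<in> charts_at M x"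
  by (auto simp: carrier_def charts_at_def)

text \<open>\<open>differential\<close> collects the partial derivatives in a vector; expanding
  \<open>w\<close> in the basis and linearity of the derivative give back the directional
  derivative.\<close>

lemma inner_differential:
  assumes "i \<in> charts_at M x" "(F \<circ> cinv M i) differentiable (at (cmap M i x))"
  shows "w \<bullet> differential M F x i = frechet_derivative (F \<circ> cinv M i) (at (cmap M i x)) w"
proof -
  let ?D = "frechet_derivative (F \<circ> cinv M i) (at (cmap M i x))"
  have "w \<bullet> differential M F x i = (\<Sum>b\<in>Basis. (w \<bullet> b) *\<^sub>R ?D b)"
    using assms(1) by (simp add: differential_def inner_sum_right mult.commute)
  also have "\<dots> = ?D (\<Sum>b\<in>Basis. (w \<bullet> b) *\<^sub>R b)"
    using linear_frechet_derivative[OF assms(2)] by (simp add: linear_sum linear_scale)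
  finally show ?thesis unfolding euclidean_representation .
qed

lemma ext_deriv_antisym: "ext_deriv M \<alpha> x i u v = - ext_deriv M \<alpha> x i v u"
  by (simp add: ext_deriv_def)

section \<open>Transition derivatives and the covectors they define\<close>

context
  fixes M :: "('i, 'a, 'b::euclidean_space) manifold"
  assumes atlas: "smooth_atlas M"
begin

lemma inj_on_cmap: "i \<in> charts M \<Longrightarrow> inj_on (cmap M i) (cdom M i)"
  using atlas unfolding smooth_atlas_def by blast

lemma open_cimage: "i \<in> charts M \<Longrightarrow> open (cimage M i)"
  using atlas unfolding smooth_atlas_def by blast

lemma cinv_cmap: "i \<in> charts M \<Longrightarrow> x \<in> cdom M i \<Longrightarrow> cinv M i (cmap M i x) = x"
  unfolding cinv_def by (rule inv_into_f_f[OF inj_on_cmap])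

lemma open_overlap:
  "i \<in> charts M \<Longrightarrow> j \<in> charts M \<Longrightarrow> open (cmap M i ` (cdom M i \<inter> cdom M j))"
  using atlas unfolding smooth_atlas_def by blast

lemma has_derivative_transition:
  assumes "i \<in> charts_at M x" "j \<in> charts_at M x"
  shows "(cmap M j \<circ> cinv M i has_derivative transition_deriv M i j x) (at (cmap M i x))"
proof -
  have "smooth_on (cmap M j \<circ> cinv M i) (cmap M i ` (cdom M i \<inter> cdom M j))"
    using atlas assms unfolding smooth_atlas_def charts_at_def by blast
  moreover have "cmap M i x \<in> cmap M i ` (cdom M i \<inter> cdom M j)"
    using assms unfolding charts_at_def by blast
  ultimately show ?thesis
    unfolding transition_deriv_def
    by (intro frechet_derivative_works[THEN iffD1] smooth_on_imp_differentiable)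
qed

text \<open>Chain rule on the overlap and uniqueness of derivatives. It is applied with
  \<open>L\<close> the identity, and with \<open>L\<close> equal to \<open>fst\<close>, which
  expresses that bundle charts share the time coordinate.\<close>

lemma transition_deriv_eqI:
  assumes "i \<in> charts_at M x" "j \<in> charts_at M x"
    "(g has_derivative D) (at (cmap M i x))"
    "\<And>y. y \<in> cdom M i \<inter> cdom M j \<Longrightarrow> g (cmap M i y) = L (cmap M j y)"
    "bounded_linear L"
  shows "D w = L (transition_deriv M i j x w)"
proof -
  have "((\<lambda>y. L ((cmap M j \<circ> cinv M i) y)) has_derivative (\<lambda>w. L (transition_deriv M i j x w)))
      (at (cmap M i x))"
    by (rule bounded_linear.has_derivative[OF assms(5) has_derivative_transition[OF assms(1,2)]])
  moreover have "((\<lambda>y. L ((cmap M j \<circ> cinv M i) y)) has_derivative D) (at (cmap M i x))"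
    by (rule has_derivative_transform_within_open[OF assms(3) open_overlap[of i j]])
      (use assms(1,2,4) in \<open>auto simp: charts_at_iff cinv_cmap\<close>)
  ultimately show ?thesis by (metis has_derivative_unique)
qed

lemma transition_deriv_refl:
  assumes "i \<in> charts_at M x"
  shows "transition_deriv M i i x w = w"
  using transition_deriv_eqI[OF assms assms has_derivative_ident, of "\<lambda>y. y" w] bounded_linear_ident
  by simp

lemma transition_deriv_trans:
  assumes "i \<in> charts_at M x" "j \<in> charts_at M x" "k \<in> charts_at M x"
  shows "transition_deriv M j k x (transition_deriv M i j x w) = transition_deriv M i k x w"
proof -
  have "(cmap M k \<circ> cinv M j has_derivative transition_deriv M j k x)
      (at ((cmap M j \<circ> cinv M i) (cmap M i x)))"
    using has_derivative_transition[OF assms(2,3)] assms by (simp add: charts_at_iff cinv_cmap)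
  from diff_chain_at[OF has_derivative_transition[OF assms(1,2)] this]
  have "((cmap M k \<circ> cinv M j) \<circ> (cmap M j \<circ> cinv M i) has_derivative
      transition_deriv M j k x \<circ> transition_deriv M i j x) (at (cmap M i x))" .
  moreover have "((cmap M k \<circ> cinv M j) \<circ> (cmap M j \<circ> cinv M i) has_derivative
      transition_deriv M i k x) (at (cmap M i x))"
    by (rule has_derivative_transform_within_open[OF has_derivative_transition[OF assms(1,3)]
          open_overlap[of i j]])
      (use assms in \<open>auto simp: charts_at_iff cinv_cmap\<close>)
  ultimately have "transition_deriv M j k x \<circ> transition_deriv M i j x = transition_deriv M i k x"
    by (rule has_derivative_unique)
  then show ?thesis by (metis comp_apply)
qed

lemma bounded_linear_transition_deriv:
  "i \<in> charts_at M x \<Longrightarrow> j \<in> charts_at M x \<Longrightarrow> bounded_linear (transition_deriv M i j x)"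
  by (rule has_derivative_bounded_linear[OF has_derivative_transition])

text \<open>The transformation law determines every component from the one in chart
  \<open>i\<close>, and the normalisation to zero settles the indices of all other charts. This
  makes the fibre coordinates injective.\<close>

lemma cotangent_space_eqI:
  assumes "a \<in> cotangent_space M x" "b \<in> cotangent_space M x" "i \<in> charts_at M x" "a i = b i"
  shows "a = b"
proof
  fix j
  show "a j = b j"
  proof (cases "j \<in> charts_at M x")
    case True
    have "w \<bullet> c j = transition_deriv M j i x w \<bullet> c i" if "c \<in> cotangent_space M x" for c w
      using that True assms(3) unfolding cotangent_space_def by blast
    then have "w \<bullet> a j = w \<bullet> b j" for w
      using assms(1,2,4) by metis
    then show ?thesis by (rule vector_eq_ldot[THEN iffD1, OF allI])
  next
    case False
    then show ?thesis using assms unfolding cotangent_space_def by simp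
  qed
qed

text \<open>The prescribed component is transported to the other charts by adjoints of transition
  derivatives; the cocycle identity \<open>transition_deriv_trans\<close> makes the family a
  covector. Hence fibre coordinates fill the whole model space.\<close>

lemma cotangent_space_component_surj:
  assumes "i \<in> charts_at M x"
  obtains a where "a \<in> cotangent_space M x" "a i = c"
proof
  let ?a = "\<lambda>j. if j \<in> charts_at M x then adjoint (transition_deriv M j i x) c else 0"
  have adj: "w \<bullet> adjoint (transition_deriv M j i x) c = transition_deriv M j i x w \<bullet> c"
    if "j \<in> charts_at M x" for j w
    by (rule adjoint_works[OF bounded_linear.linear[OF bounded_linear_transition_deriv[OF that assms]]])
  show "?a \<in> cotangent_space M x"
    unfolding cotangent_space_def
    using transition_deriv_trans assms by (simp add: adj)
  have "w \<bullet> ?a i = w \<bullet> c" for w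
    using assms by (simp add: adj transition_deriv_refl)
  then show "?a i = c" by (rule vector_eq_ldot[THEN iffD1, OF allI])
qed

end

section \<open>The atlas of the cotangent bundle and the symplectic form in coordinates\<close>

lemma charts_cotangent_bundle [simp]: "charts (cotangent_bundle M) = charts M"
  by (simp add: cotangent_bundle_def)

lemma cdom_cotangent_bundle:
  "z \<in> cdom (cotangent_bundle M) i \<longleftrightarrow> fst z \<in> cdom M i \<and> snd z \<in> cotangent_space M (fst z)"
  by (auto simp: cotangent_bundle_def)

lemma cmap_cotangent_bundle: "cmap (cotangent_bundle M) i z = (cmap M i (fst z), snd z i)"
  by (simp add: cotangent_bundle_def case_prod_unfold)

context
  fixes M :: "('i, 'a, 'b::euclidean_space) manifold"
  assumes atlas: "smooth_atlas M"
begin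

lemma inj_on_cmap_cotangent_bundle:
  assumes i: "i \<in> charts M"
  shows "inj_on (cmap (cotangent_bundle M) i) (cdom (cotangent_bundle M) i)"
proof (rule inj_onI)
  fix y z assume y: "y \<in> cdom (cotangent_bundle M) i" and z: "z \<in> cdom (cotangent_bundle M) i"
    and eq: "cmap (cotangent_bundle M) i y = cmap (cotangent_bundle M) i z"
  have "fst y = fst z"
    using y z eq inj_on_cmap[OF atlas i]
    by (auto simp: cdom_cotangent_bundle cmap_cotangent_bundle inj_on_def)
  moreover from this have "snd y = snd z"
    using y z eq i
    by (intro cotangent_space_eqI[OF atlas, of _ "fst z" _ i])
      (auto simp: cdom_cotangent_bundle cmap_cotangent_bundle charts_at_iff)
  ultimately show "y = z" by (rule prod_eqI)
qed

lemma cimage_cotangent_bundle: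
  assumes i: "i \<in> charts M"
  shows "cimage (cotangent_bundle M) i = cimage M i \<times> UNIV"
proof
  show "cimage (cotangent_bundle M) i \<subseteq> cimage M i \<times> UNIV"
    by (auto simp: cimage_def cdom_cotangent_bundle cmap_cotangent_bundle)
  show "cimage M i \<times> UNIV \<subseteq> cimage (cotangent_bundle M) i"
  proof
    fix y :: "'b \<times> 'b" assume "y \<in> cimage M i \<times> UNIV"
    then obtain x where x: "x \<in> cdom M i" "fst y = cmap M i x" by (auto simp: cimage_def)
    obtain a where "a \<in> cotangent_space M x" "a i = snd y"
      using cotangent_space_component_surj[OF atlas, of i x "snd y"] x i by (auto simp: charts_at_iff)
    with x have "(x, a) \<in> cdom (cotangent_bundle M) i" "cmap (cotangent_bundle M) i (x, a) = y"
      by (auto simp: cdom_cotangent_bundle cmap_cotangent_bundle prod_eq_iff)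
    then show "y \<in> cimage (cotangent_bundle M) i" by (metis cmap_in_cimage)
  qed
qed

lemma open_cimage_cotangent_bundle: "i \<in> charts M \<Longrightarrow> open (cimage (cotangent_bundle M) i)"
  by (simp add: cimage_cotangent_bundle open_cimage[OF atlas] open_Times)

lemma cinv_cmap_cotangent_bundle:
  "i \<in> charts M \<Longrightarrow> z \<in> cdom (cotangent_bundle M) i \<Longrightarrow>
    cinv (cotangent_bundle M) i (cmap (cotangent_bundle M) i z) = z"
  unfolding cinv_def by (rule inv_into_f_f[OF inj_on_cmap_cotangent_bundle])

text \<open>In a chart the canonical form is linear in the fibre coordinates, so its exterior
  derivative has constant coefficients: it is the sum of dp_a wedge dq^a over all base coordinates.
  The point \<open>z\<close> is absent from the formula, which later allows passing between points
  of one fibre of \<rho>.\<close>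

lemma canonical_symplectic_eq:
  assumes i: "i \<in> charts M" and z: "z \<in> cdom (cotangent_bundle M) i"
  shows "canonical_symplectic M z i u v = fst v \<bullet> snd u - fst u \<bullet> snd v"
proof -
  let ?T = "cotangent_bundle M"
  have "frechet_derivative (\<lambda>y. w \<bullet> canonical_form (cinv ?T i y) i) (at (cmap ?T i z)) =
      (\<lambda>u. fst w \<bullet> snd u)" for w :: "'b \<times> 'b"
  proof -
    have "frechet_derivative (\<lambda>y. w \<bullet> canonical_form (cinv ?T i y) i) (at (cmap ?T i z)) =
        frechet_derivative (\<lambda>y. fst w \<bullet> snd y) (at (cmap ?T i z))"
    proof (rule frechet_derivative_cong_open[OF open_cimage_cotangent_bundle[OF i] cmap_in_cimage[OF z]])
      fix y assume "y \<in> cimage ?T i"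
      from arg_cong[OF cmap_cinv[OF this], of snd] show "w \<bullet> canonical_form (cinv ?T i y) i = fst w \<bullet> snd y"
        by (auto simp: cmap_cotangent_bundle canonical_form_def inner_prod_def)
    qed
    also have "\<dots> = (\<lambda>u. fst w \<bullet> snd u)"
      by (rule frechet_derivative_at[symmetric]) (auto intro!: derivative_eq_intros)
    finally show ?thesis .
  qed
  then show ?thesis by (simp add: canonical_symplectic_def ext_deriv_def)
qed

text \<open>Test vectors along the fibre detect the base component, test vectors along the base the
  fibre component.\<close>

lemma canonical_symplectic_nondegenerate:
  assumes i: "i \<in> charts M" and z: "z \<in> cdom (cotangent_bundle M) i"
    and eq: "\<And>w. canonical_symplectic M z i u w = canonical_symplectic M z i v w"
  shows "u = v"
proof (rule prod_eqI)
  have "w \<bullet> fst u = w \<bullet> fst v" for w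
    using eq[of "(0, w)"] by (simp add: canonical_symplectic_eq[OF i z] inner_commute)
  then show "fst u = fst v" by (rule vector_eq_ldot[THEN iffD1, OF allI])
  have "w \<bullet> snd u = w \<bullet> snd v" for w
    using eq[of "(w, 0)"] by (simp add: canonical_symplectic_eq[OF i z])
  then show "snd u = snd v" by (rule vector_eq_ldot[THEN iffD1, OF allI])
qed

end

section \<open>Charts of the dual jet bundle\<close>

text \<open>The coordinate expression of \<rho>: it drops \<open>p0\<close> from
  \<open>((t, q), (p0, p))\<close>. The same formula serves for tangent vectors.\<close>

definition dual_proj :: "('b \<times> real \<times> 'c) \<Rightarrow> 'b \<times> 'c" where
  "dual_proj v = (fst v, snd (snd v))"

lemma bounded_linear_dual_proj:
  "bounded_linear (dual_proj :: 'b::real_normed_vector \<times> real \<times> 'c::real_normed_vector \<Rightarrow> 'b \<times> 'c)"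
  unfolding dual_proj_def
  by (intro bounded_linear_Pair bounded_linear_fst bounded_linear_compose[OF bounded_linear_snd bounded_linear_snd])

locale bundle_atlas =
  fixes E :: "('i, 'e, real \<times> (real ^ 'n)) manifold" and \<tau> :: "'e \<Rightarrow> real"
  assumes atlas: "smooth_atlas E"
    and fst_cmap: "\<And>i e. i \<in> charts E \<Longrightarrow> e \<in> cdom E i \<Longrightarrow> fst (cmap E i e) = \<tau> e"
begin

abbreviation (input) "T \<equiv> cotangent_bundle E"
abbreviation (input) "J \<equiv> dual_jet_bundle E \<tau>"

text \<open>The action of the real line on covectors by adding multiples of dt. Its orbits are the
  fibres of \<open>rho\<close>, and the section function measures displacement along an
  orbit.\<close>

definition translate ::
  "real \<Rightarrow> ('i, 'e, real \<times> (real ^ 'n)) covector \<Rightarrow> ('i, 'e, real \<times> (real ^ 'n)) covector" where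
  "translate s z = (fst z, \<lambda>i. snd z i + s *\<^sub>R differential E \<tau> (fst z) i)"

text \<open>In a bundle chart \<tau> is the first coordinate, so its derivative is
  \<open>fst\<close>, that is, pairing with \<open>(1, 0)\<close>.\<close>

lemma differential_time:
  assumes "i \<in> charts_at E e"
  shows "differential E \<tau> e i = (1, 0)"
proof -
  have i: "i \<in> charts E" "e \<in> cdom E i" using assms by (auto simp: charts_at_iff)
  have d: "(\<tau> \<circ> cinv E i has_derivative fst) (at (cmap E i e))"
    by (rule has_derivative_transform_within_open[OF has_derivative_fst[OF has_derivative_ident]
          open_cimage[OF atlas i(1)] cmap_in_cimage[OF i(2)]])
      (metis comp_apply cinv_in_cdom cmap_cinv fst_cmap[OF i(1)])
  have "w \<bullet> differential E \<tau> e i = w \<bullet> (1, 0)" for w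
    using inner_differential[OF assms differentiableI[OF d]]
      fun_cong[OF frechet_derivative_at[OF d], of w] inner_prod_def[of w "(1, 0)"] by simp
  then show ?thesis by (rule vector_eq_ldot[THEN iffD1, OF allI])
qed

text \<open>Transition maps between bundle charts preserve the time coordinate, so their derivatives
  preserve the first component of a vector.\<close>

lemma differential_time_in_cotangent_space: "differential E \<tau> e \<in> cotangent_space E e"
  unfolding cotangent_space_def
proof (intro CollectI conjI ballI allI impI)
  fix i j w assume ij: "i \<in> charts_at E e" "j \<in> charts_at E e"
  have "fst w = fst (transition_deriv E i j e w)"
    by (rule transition_deriv_eqI[OF atlas ij has_derivative_fst[OF has_derivative_ident]])
      (use ij in \<open>auto simp: charts_at_iff fst_cmap bounded_linear_fst\<close>)
  then show "w \<bullet> differential E \<tau> e i = transition_deriv E i j e w \<bullet> differential E \<tau> e j"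
    by (simp add: differential_time[OF ij(1)] differential_time[OF ij(2)] inner_prod_def)
qed (simp add: differential_def)

lemma fst_translate [simp]: "fst (translate s z) = fst z"
  by (simp add: translate_def)

lemma translate_0 [simp]: "translate 0 z = z"
  by (simp add: translate_def)

lemma translate_translate [simp]: "translate s (translate r z) = translate (s + r) z"
  by (simp add: translate_def scaleR_add_left add_ac)

lemma translate_in_cdom [simp]: "translate s z \<in> cdom T i \<longleftrightarrow> z \<in> cdom T i"
proof -
  have "translate s y \<in> cdom T i" if "y \<in> cdom T i" for s y
    using that differential_time_in_cotangent_space[of "fst y"]
    unfolding cdom_cotangent_bundle translate_def cotangent_space_def
    by (auto simp: inner_add_right)
  from this[of z s] this[of "translate s z" "- s"] show ?thesis by auto
qed

lemma cmap_translate: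
  assumes "i \<in> charts E" "z \<in> cdom T i"
  shows "cmap T i (translate s z) = cmap T i z + (0, (s, 0))"
proof -
  have "differential E \<tau> (fst z) i = (1, 0)"
    using assms by (intro differential_time) (simp add: charts_at_iff cdom_cotangent_bundle)
  then show ?thesis
    by (simp add: cmap_cotangent_bundle translate_def)
qed

lemma rho_eq: "rho E \<tau> z = range (\<lambda>s. translate s z)"
  by (auto simp: rho_def translate_def)

lemma rho_translate: "rho E \<tau> (translate s z) = rho E \<tau> z"
proof -
  have "range (\<lambda>r. translate (r + s) z) = (\<lambda>r. translate r z) ` range (\<lambda>r. r + s)"
    by (rule image_image[symmetric])
  also have "range (\<lambda>r. r + s) = UNIV" by (rule surj_plus_right)
  finally show ?thesis by (simp add: rho_eq)
qed

lemma rho_eqD: "rho E \<tau> y = rho E \<tau> z \<Longrightarrow> \<exists>s. y = translate s z"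
  unfolding rho_eq by (metis (no_types, lifting) image_iff rangeI translate_0)

text \<open>The charts of the dual jet bundle and \<open>dual_jet_time\<close> choose a
  representative of the coset; knowing it up to translation suffices, as both are invariant under
  translation.\<close>

lemma some_in_rho: "\<exists>s. (SOME y. y \<in> rho E \<tau> z) = translate s z"
  using someI[of "\<lambda>y. y \<in> rho E \<tau> z" "translate 0 z"] unfolding rho_eq by blast

section \<open>The atlas of the dual jet bundle and the projection in coordinates\<close>

lemma charts_dual_jet_bundle [simp]: "charts J = charts E"
  by (simp add: dual_jet_bundle_def)

lemma rho_in_cdom [simp]: "rho E \<tau> z \<in> cdom J i \<longleftrightarrow> z \<in> cdom T i"
  by (auto simp: dual_jet_bundle_def dest: rho_eqD)

lemma cdom_dual_jet_bundleE:
  assumes "x \<in> cdom J i"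
  obtains z where "z \<in> cdom T i" "x = rho E \<tau> z"
  using assms by (auto simp: dual_jet_bundle_def)

lemma rho_in_carrier [simp]: "rho E \<tau> z \<in> carrier J \<longleftrightarrow> z \<in> carrier T"
  by (simp add: carrier_def)

lemma charts_at_rho [simp]: "charts_at J (rho E \<tau> z) = charts_at T z"
  by (simp add: charts_at_def)

text \<open>The chosen representative is a translate of \<open>z\<close>, and translation changes
  only the coordinate \<open>p0\<close>, which \<open>dual_proj\<close> discards.\<close>

lemma cmap_rho:
  assumes i: "i \<in> charts E" and z: "z \<in> cdom T i"
  shows "cmap J i (rho E \<tau> z) = dual_proj (cmap T i z)"
proof -
  obtain s where s: "(SOME y. y \<in> rho E \<tau> z) = translate s z" using some_in_rho by blast
  have "cmap J i (rho E \<tau> z) = dual_proj (cmap T i (translate s z))"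
    by (simp add: dual_jet_bundle_def s case_prod_unfold cmap_cotangent_bundle dual_proj_def)
  then show ?thesis by (simp add: cmap_translate[OF i z] dual_proj_def)
qed

lemma inj_on_cmap_dual_jet_bundle:
  assumes i: "i \<in> charts E"
  shows "inj_on (cmap J i) (cdom J i)"
proof (rule inj_onI)
  fix x y assume "x \<in> cdom J i" "y \<in> cdom J i" and eq: "cmap J i x = cmap J i y"
  then obtain u v where u: "u \<in> cdom T i" "x = rho E \<tau> u" and v: "v \<in> cdom T i" "y = rho E \<tau> v"
    by (auto elim!: cdom_dual_jet_bundleE)
  \<comment> \<open>The difference of the \<open>p0\<close> coordinates; translating
    \<open>v\<close> by it makes all coordinates agree with those of \<open>u\<close>.\<close>
  let ?s = "fst (snd (cmap T i u)) - fst (snd (cmap T i v))"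
  have "cmap T i (translate ?s v) = cmap T i u"
    using eq u v i by (simp add: cmap_rho cmap_translate dual_proj_def prod_eq_iff)
  then have "translate ?s v = u"
    using inj_onD[OF inj_on_cmap_cotangent_bundle[OF atlas i]] u(1) v(1) by simp
  then show "x = y" using u v rho_translate by metis
qed

lemma cimage_dual_jet_bundle:
  assumes i: "i \<in> charts E"
  shows "cimage J i = cimage E i \<times> UNIV"
proof -
  have "cdom J i = rho E \<tau> ` cdom T i" by (simp add: dual_jet_bundle_def)
  then have "cimage J i = dual_proj ` cimage T i"
    unfolding cimage_def by (simp add: image_image cmap_rho[OF i] cong: image_cong)
  also have "\<dots> = cimage E i \<times> UNIV"
    by (force simp: cimage_cotangent_bundle[OF atlas i] dual_proj_def image_iff)
  finally show ?thesis .
qed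

lemma open_cimage_dual_jet_bundle: "i \<in> charts E \<Longrightarrow> open (cimage J i)"
  by (simp add: cimage_dual_jet_bundle open_cimage[OF atlas] open_Times)

lemma cinv_cmap_dual_jet_bundle: "i \<in> charts E \<Longrightarrow> x \<in> cdom J i \<Longrightarrow> cinv J i (cmap J i x) = x"
  unfolding cinv_def by (rule inv_into_f_f[OF inj_on_cmap_dual_jet_bundle])

lemma cinv_dual_proj:
  assumes "i \<in> charts E" "y \<in> cimage T i"
  shows "cinv J i (dual_proj y) = rho E \<tau> (cinv T i y)"
  using cinv_cmap_dual_jet_bundle[OF assms(1), of "rho E \<tau> (cinv T i y)"] assms
  by (simp add: cmap_rho cinv_in_cdom cmap_cinv)

text \<open>In bundle charts \<rho> is a linear map, hence its own derivative.\<close>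

lemma tangent_map_rho:
  assumes "i \<in> charts E" "z \<in> cdom T i"
  shows "tangent_map T J (rho E \<tau>) z i = dual_proj"
proof -
  have "tangent_map T J (rho E \<tau>) z i = frechet_derivative dual_proj (at (cmap T i z))"
    unfolding tangent_map_def
    by (rule frechet_derivative_cong_open[OF open_cimage_cotangent_bundle[OF atlas assms(1)]
          cmap_in_cimage[OF assms(2)]])
      (simp add: cmap_rho[OF assms(1)] cinv_in_cdom cmap_cinv)
  also have "\<dots> = dual_proj"
    by (rule frechet_derivative_at[symmetric] bounded_linear_imp_has_derivative bounded_linear_dual_proj)+
  finally show ?thesis .
qed

lemma inner_differential_dual_jet_time:
  assumes i: "i \<in> charts E" and z: "z \<in> cdom T i"
  shows "w \<bullet> differential J (dual_jet_time \<tau>) (rho E \<tau> z) i = fst (fst w)"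
proof -
  have t: "dual_jet_time \<tau> (rho E \<tau> y) = fst (fst (cmap J i (rho E \<tau> y)))" if "y \<in> cdom T i" for y
  proof -
    have "dual_jet_time \<tau> (rho E \<tau> y) = \<tau> (fst y)"
      using some_in_rho[of y] by (auto simp: dual_jet_time_def)
    then show ?thesis
      using that by (simp add: cmap_rho[OF i] dual_proj_def cmap_cotangent_bundle
          cdom_cotangent_bundle fst_cmap[OF i])
  qed
  let ?x = "cmap J i (rho E \<tau> z)"
  have d: "(dual_jet_time \<tau> \<circ> cinv J i has_derivative (\<lambda>w. fst (fst w))) (at ?x)"
  proof (rule has_derivative_transform_within_open[OF _ open_cimage_dual_jet_bundle[OF i]])
    show "((\<lambda>y. fst (fst y)) has_derivative (\<lambda>w. fst (fst w))) (at ?x)"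
      by (intro has_derivative_fst has_derivative_ident)
    show "?x \<in> cimage J i" using z by (intro cmap_in_cimage) simp
    show "fst (fst y) = (dual_jet_time \<tau> \<circ> cinv J i) y" if y: "y \<in> cimage J i" for y
    proof -
      obtain u where "u \<in> cdom T i" "cinv J i y = rho E \<tau> u"
        using cinv_in_cdom[OF y] by (rule cdom_dual_jet_bundleE)
      with t[of u] cmap_cinv[OF y] show ?thesis by simp
    qed
  qed
  have "i \<in> charts_at J (rho E \<tau> z)" using i z by (simp add: charts_at_iff)
  from inner_differential[OF this differentiableI[OF d]] show ?thesis
    using fun_cong[OF frechet_derivative_at[OF d]] by simp
qed

end

section \<open>Hamiltonian sections and complete lifts\<close>

text \<open>The only chart of the source is the identity of \<open>W\<close>, so the chart
  expressions of \<open>f\<close> involve the charts of the target alone.\<close>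

lemma smooth_map_euclidean_manifold:
  "smooth_map (euclidean_manifold W) M f \<longleftrightarrow>
     f ` W \<subseteq> carrier M \<and>
     (\<forall>j\<in>charts M. open {w \<in> W. f w \<in> cdom M j} \<and>
        smooth_on (cmap M j \<circ> f) {w \<in> W. f w \<in> cdom M j})"
proof -
  have "cinv (euclidean_manifold W) u w = w" if "w \<in> W" for u w
    using inv_into_f_f[of "\<lambda>x. x" W w] that
    by (simp add: cinv_def euclidean_manifold_def)
  then have "smooth_on (cmap M j \<circ> f \<circ> cinv (euclidean_manifold W) u) {w \<in> W. f w \<in> cdom M j}
      \<longleftrightarrow> smooth_on (cmap M j \<circ> f) {w \<in> W. f w \<in> cdom M j}"
    if "open {w \<in> W. f w \<in> cdom M j}" for j u
    by (intro smooth_on_cong[OF that]) simp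
  then show ?thesis
    by (auto simp: smooth_map_def euclidean_manifold_def carrier_def)
qed

section \<open>The section, its function and the Hamiltonian fields in bundle charts\<close>

locale hamiltonian_atlas = bundle_atlas +
  fixes h
  assumes section_h: "hamiltonian_section E \<tau> h"
begin

lemma rho_section: "x \<in> carrier J \<Longrightarrow> rho E \<tau> (h x) = x"
  using section_h by (simp add: hamiltonian_section_def)

text \<open>A section of \<rho> covers the identity of E, so one index \<open>i\<close> serves at
  \<open>x\<close> and at \<open>h x\<close>, as \<open>tangent_map\<close> presupposes.\<close>

lemma section_in_cdom: "x \<in> carrier J \<Longrightarrow> h x \<in> cdom T i \<longleftrightarrow> x \<in> cdom J i"
  using rho_in_cdom[of "h x" i] rho_section[of x] by simp

lemma section_in_carrier: "x \<in> carrier J \<Longrightarrow> h x \<in> carrier T"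
  using rho_in_carrier[of "h x"] rho_section[of x] by simp

lemma dual_proj_cmap_section:
  assumes "i \<in> charts E" "x \<in> cdom J i"
  shows "dual_proj (cmap T i (h x)) = cmap J i x"
proof -
  have "x \<in> carrier J" using assms by (intro cdom_subset_carrier[of i]) simp_all
  with cmap_rho[OF assms(1), of "h x"] show ?thesis
    by (simp add: assms section_in_cdom rho_section)
qed

text \<open>\<open>z\<close> and \<open>h (rho E \<tau> z)\<close> lie in the same coset and so
  differ by a multiple of dt. The multiple is unique because dt is \<open>(1, 0)\<close> in every
  bundle chart; thus the description in \<open>section_function\<close> denotes it.\<close>

lemma translate_section_function:
  assumes z: "z \<in> carrier T"
  shows "translate (section_function E \<tau> h z) (h (rho E \<tau> z)) = z"
proof -
  have "rho E \<tau> z = rho E \<tau> (h (rho E \<tau> z))" using z by (simp add: rho_section)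
  then obtain s where s: "z = translate s (h (rho E \<tau> z))" using rho_eqD by blast
  then have e: "fst z = fst (h (rho E \<tau> z))" by (metis fst_translate)
  obtain i where "i \<in> charts_at E (fst z)"
    using z by (auto simp: carrier_def cdom_cotangent_bundle charts_at_iff)
  have d: "snd z j - snd (h (rho E \<tau> z)) j = s *\<^sub>R differential E \<tau> (fst z) j" for j
    using arg_cong[OF s, of "\<lambda>y. snd y j"] e by (simp add: translate_def)
  have "section_function E \<tau> h z = s"
    unfolding section_function_def
  proof (rule the_equality)
    fix r assume "\<forall>j\<in>charts_at E (fst z).
      snd z j - snd (h (rho E \<tau> z)) j = r *\<^sub>R differential E \<tau> (fst z) j"
    then have "r *\<^sub>R differential E \<tau> (fst z) i = s *\<^sub>R differential E \<tau> (fst z) i"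
      using d \<open>i \<in> _\<close> by metis
    then show "r = s" by (simp add: differential_time[OF \<open>i \<in> _\<close>])
  qed (simp add: d)
  then show ?thesis using s by simp
qed

text \<open>This is the classical p0 + H, since the \<open>p0\<close> coordinate of the section is
  -H.\<close>

lemma section_function_eq:
  assumes i: "i \<in> charts E" and z: "z \<in> cdom T i"
  shows "section_function E \<tau> h z = fst (snd (cmap T i z)) - fst (snd (cmap T i (h (rho E \<tau> z))))"
proof -
  have c: "z \<in> carrier T" using i z by (intro cdom_subset_carrier[of i]) simp_all
  then have "h (rho E \<tau> z) \<in> cdom T i" using z by (simp add: section_in_cdom)
  from cmap_translate[OF i this, of "section_function E \<tau> h z"] translate_section_function[OF c]
  have "cmap T i z = cmap T i (h (rho E \<tau> z)) + (0, section_function E \<tau> h z, 0)" by simp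
  then show ?thesis by simp
qed

lemma smooth_on_section:
  assumes i: "i \<in> charts E"
  shows "smooth_on (cmap T i \<circ> h \<circ> cinv J i) (cimage J i)"
proof -
  have "{x \<in> cdom J i. h x \<in> cdom T i} = cdom J i"
    using i by (auto simp: section_in_cdom[OF cdom_subset_carrier[of i]])
  moreover have "smooth_on (cmap T i \<circ> h \<circ> cinv J i)
      (cmap J i ` {x \<in> cdom J i. h x \<in> cdom T i})"
    using section_h i by (simp add: hamiltonian_section_def smooth_map_def)
  ultimately show ?thesis by (simp only: cimage_def)
qed

lemma has_derivative_section:
  assumes "i \<in> charts E" "x \<in> cdom J i"
  shows "(cmap T i \<circ> h \<circ> cinv J i has_derivative tangent_map J T h x i) (at (cmap J i x))"
  unfolding tangent_map_def frechet_derivative_works[symmetric]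
  by (rule smooth_on_imp_differentiable[OF smooth_on_section[OF assms(1)] cmap_in_cimage[OF assms(2)]])

text \<open>The derivative of the identity \<rho> o h = id. So the derivative of \<open>h\<close> is
  injective, with left inverse \<open>dual_proj\<close>.\<close>

lemma dual_proj_tangent_section:
  assumes i: "i \<in> charts E" and x: "x \<in> cdom J i"
  shows "dual_proj (tangent_map J T h x i v) = v"
proof -
  let ?G = "cmap T i \<circ> h \<circ> cinv J i"
  have "((\<lambda>y. dual_proj (?G y)) has_derivative (\<lambda>v. dual_proj (tangent_map J T h x i v)))
      (at (cmap J i x))"
    by (rule bounded_linear.has_derivative[OF bounded_linear_dual_proj has_derivative_section[OF i x]])
  moreover have "((\<lambda>y. dual_proj (?G y)) has_derivative (\<lambda>v. v)) (at (cmap J i x))"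
    by (rule has_derivative_transform_within_open[OF has_derivative_ident
          open_cimage_dual_jet_bundle[OF i] cmap_in_cimage[OF x]])
      (simp add: dual_proj_cmap_section[OF i] cinv_in_cdom cmap_cinv)
  ultimately show ?thesis by (metis has_derivative_unique)
qed

text \<open>The coordinate formula is differentiated by the chain rule. The result vanishes at
  \<open>w\<close> exactly when \<open>w\<close> is the image under the derivative of
  \<open>h\<close> of its own projection, that is, when \<open>w\<close> is tangent to a level
  set.\<close>

lemma has_derivative_section_function:
  assumes i: "i \<in> charts E" and z: "z \<in> cdom T i"
  shows "(section_function E \<tau> h \<circ> cinv T i has_derivative
      (\<lambda>w. fst (snd w) - fst (snd (tangent_map J T h (rho E \<tau> z) i (dual_proj w)))))
    (at (cmap T i z))"
proof (rule has_derivative_transform_within_open[OF _ open_cimage_cotangent_bundle[OF atlas i]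
      cmap_in_cimage[OF z]])
  let ?G = "cmap T i \<circ> h \<circ> cinv J i"
  have "(?G has_derivative tangent_map J T h (rho E \<tau> z) i) (at (dual_proj (cmap T i z)))"
    using has_derivative_section[OF i, of "rho E \<tau> z"] z by (simp add: cmap_rho[OF i])
  with bounded_linear_imp_has_derivative[OF bounded_linear_dual_proj]
  have "((\<lambda>y. ?G (dual_proj y)) has_derivative
      (\<lambda>w. tangent_map J T h (rho E \<tau> z) i (dual_proj w))) (at (cmap T i z))"
    by (rule has_derivative_compose)
  then show "((\<lambda>y. fst (snd y) - fst (snd (?G (dual_proj y)))) has_derivative
      (\<lambda>w. fst (snd w) - fst (snd (tangent_map J T h (rho E \<tau> z) i (dual_proj w)))))
    (at (cmap T i z))"
    by (intro has_derivative_diff has_derivative_fst has_derivative_snd has_derivative_ident)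
  show "fst (snd y) - fst (snd (?G (dual_proj y))) = (section_function E \<tau> h \<circ> cinv T i) y"
    if "y \<in> cimage T i" for y
    using section_function_eq[OF i cinv_in_cdom[OF that]] that
    by (simp add: cinv_dual_proj[OF i] cmap_cinv)
qed

lemma inner_differential_section_function:
  assumes i: "i \<in> charts E" and z: "z \<in> cdom T i"
  shows "w \<bullet> differential T (section_function E \<tau> h) z i =
    fst (snd w) - fst (snd (tangent_map J T h (rho E \<tau> z) i (dual_proj w)))"
proof -
  note d = has_derivative_section_function[OF i z]
  have "i \<in> charts_at T z" using i z by (simp add: charts_at_iff)
  from inner_differential[OF this differentiableI[OF d]] show ?thesis
    using fun_cong[OF frechet_derivative_at[OF d], of w] by simp
qed

text \<open>The image of \<open>Y\<close> under the derivative of \<open>h\<close> solves the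
  equation that defines \<open>X\<close>, and nondegeneracy makes the solution unique. A test vector
  is split into a vector tangent to the level set, which contributes nothing because
  \<open>Y\<close> annihilates the pulled-back form, and a multiple of d/dp0, whose contribution is
  fixed by the unit time component of \<open>Y\<close>.\<close>

lemma hamiltonian_field_eq:
  assumes X: "hamiltonian_field_cotangent E (section_function E \<tau> h) X"
    and Y: "hamiltonian_field_dual_jet E \<tau> h Y"
    and i: "i \<in> charts E" and z: "z \<in> cdom T i"
  shows "X z i = tangent_map J T h (rho E \<tau> z) i (Y (rho E \<tau> z) i)"
proof (rule canonical_symplectic_nondegenerate[OF atlas i z])
  fix w
  let ?x = "rho E \<tau> z"
  let ?D = "tangent_map J T h ?x i"
  have zc: "z \<in> carrier T" using i z by (intro cdom_subset_carrier[of i]) simp_all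
  have ia: "i \<in> charts_at T z" using i z by (simp add: charts_at_iff)
  have xc: "?x \<in> carrier J" and xa: "i \<in> charts_at J ?x" using zc ia by simp_all
  have hx: "h ?x \<in> cdom T i" using zc z by (simp add: section_in_cdom)
  have P: "dual_proj (?D v) = v" for v
    using dual_proj_tangent_section[OF i, of ?x] z by simp
  \<comment> \<open>The differential of the section function at \<open>w\<close>, which is also the
    coefficient of d/dp0 in the splitting of \<open>w\<close>.\<close>
  define c where "c = fst (snd w) - fst (snd (?D (dual_proj w)))"
  have "dual_proj w = dual_proj (?D (dual_proj w))" by (simp add: P)
  then have w: "w = ?D (dual_proj w) + (0, (c, 0))"
    by (simp add: c_def dual_proj_def prod_eq_iff)
  have "canonical_symplectic E (h ?x) i (?D (Y ?x i)) (?D (dual_proj w)) = 0"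
    using Y xc xa unfolding hamiltonian_field_dual_jet_def pullback2_def by blast
  \<comment> \<open>The pullback condition lives at \<open>h ?x\<close>; it passes to the translate
    \<open>z\<close> because \<omega> has constant coefficients in the chart.\<close>
  then have 1: "canonical_symplectic E z i (?D (Y ?x i)) (?D (dual_proj w)) = 0"
    by (simp add: canonical_symplectic_eq[OF atlas i hx] canonical_symplectic_eq[OF atlas i z])
  have "Y ?x i \<bullet> differential J (dual_jet_time \<tau>) ?x i = 1"
    using Y xc xa unfolding hamiltonian_field_dual_jet_def by blast
  then have "fst (fst (?D (Y ?x i))) = 1"
    using inner_differential_dual_jet_time[OF i z] arg_cong[OF P[of "Y ?x i"], of fst]
    by (simp add: dual_proj_def)
  then have 2: "canonical_symplectic E z i (?D (Y ?x i)) (0, (c, 0)) = - c"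
    by (simp add: canonical_symplectic_eq[OF atlas i z] inner_prod_def)
  have "canonical_symplectic E z i (?D (Y ?x i)) (?D (dual_proj w) + (0, (c, 0))) = - c"
    using 1 2 unfolding canonical_symplectic_eq[OF atlas i z]
    by (simp add: inner_add_left inner_add_right)
  then have "canonical_symplectic E z i (?D (Y ?x i)) w = - c" using w by simp
  moreover have "canonical_symplectic E z i (X z i) w = - c"
    using X zc ia unfolding hamiltonian_field_cotangent_def c_def
      inner_differential_section_function[OF i z, of w, symmetric] by blast
  ultimately show "canonical_symplectic E z i (X z i) w = canonical_symplectic E z i (?D (Y ?x i)) w"
    by simp
qed

end

section \<open>Powers of the complete lifts and the distributions they span\<close>

lemma vector_field_complete_lift_power:
  assumes "smooth_atlas M" "complete_lift_cotangent M R RT" "vector_field (cotangent_bundle M) X"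
  shows "vector_field (cotangent_bundle M) ((tensor_vec RT ^^ k) X)"
proof (induction k)
  case (Suc k)
  then show ?case
    using assms(2) unfolding complete_lift_cotangent_def funpow.simps comp_apply
    by (intro vector_field_tensor_vec)
      (simp_all add: open_cimage_cotangent_bundle[OF assms(1)])
qed (simp add: assms(3))

text \<open>The complete lift is symmetric with respect to the symplectic form, since the pullback that
  defines it is alternating.\<close>

lemma complete_lift_power_isotropic:
  assumes "smooth_atlas M" "complete_lift_cotangent M R RT" "vector_field (cotangent_bundle M) X"
    and z: "z \<in> carrier (cotangent_bundle M)" "i \<in> charts_at (cotangent_bundle M) z"
  shows "canonical_symplectic M z i (((tensor_vec RT ^^ k) X) z i) (X z i) = 0"
proof -
  define Y where "Y k = (tensor_vec RT ^^ k) X" for k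
  define B where "B k l = canonical_symplectic M z i (Y k z i) (Y l z i)" for k l
  have anti: "B k l = - B l k" for k l
    unfolding B_def canonical_symplectic_def by (rule ext_deriv_antisym)
  have lift: "B (Suc k) l = pullback2 (cotangent_bundle M) (cotangent_bundle M) (tau_map M R)
      (canonical_symplectic M) z i (Y k z i) (Y l z i)" for k l
    using assms(2) z vector_field_complete_lift_power[OF assms(1-3), of k]
    unfolding complete_lift_cotangent_def B_def Y_def funpow.simps comp_apply by blast
  have shift: "B (Suc k) l = B k (Suc l)" for k l
  proof -
    have "B (Suc k) l = - B (Suc l) k"
      unfolding lift pullback2_def canonical_symplectic_def by (rule ext_deriv_antisym)
    then show ?thesis using anti[of "Suc l" k] by simp
  qed
  have "B k l = B 0 (k + l)" for k l
    by (induction k arbitrary: l) (simp_all add: shift)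
  \<comment> \<open>Moving all powers into the second argument gives \<open>B k 0 = B 0 k\<close>,
    and antisymmetry turns this into \<open>B k 0 = - B k 0\<close>.\<close>
  from this[of k 0] anti[of k 0] have "B k 0 = 0" by simp
  then show ?thesis by (simp add: B_def Y_def)
qed

context hamiltonian_atlas
begin

text \<open>The vector field property is carried through the induction because
  \<open>complete_lift_dual_jet\<close> preserves relatedness for pairs of vector fields.\<close>

lemma complete_lift_powers_related:
  assumes RT: "complete_lift_cotangent E R RT" and RJ: "complete_lift_dual_jet E \<tau> RT RJ"
    and X: "vector_field T X" and Y: "vector_field J Y" and rel: "related T J (rho E \<tau>) X Y"
  shows "vector_field J ((tensor_vec RJ ^^ k) Y) \<and>
    related T J (rho E \<tau>) ((tensor_vec RT ^^ k) X) ((tensor_vec RJ ^^ k) Y)"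
proof (induction k)
  case (Suc k)
  have "vector_field J (tensor_vec RJ ((tensor_vec RJ ^^ k) Y))"
    using RJ Suc unfolding complete_lift_dual_jet_def
    by (intro vector_field_tensor_vec)
      (simp_all add: open_cimage_dual_jet_bundle)
  then show ?case
    using RJ Suc vector_field_complete_lift_power[OF atlas RT X, of k]
    unfolding complete_lift_dual_jet_def by simp
qed (simp add: Y rel)

text \<open>Isotropy makes each power tangent to the level set, so it is recovered from its
  projection by the derivative of \<open>h\<close>; by relatedness the projection is the
  corresponding power below. Linearity extends this from the generators to their spans.\<close>

lemma krylov_distribution_eq:
  assumes RT: "complete_lift_cotangent E R RT" and RJ: "complete_lift_dual_jet E \<tau> RT RJ"
    and X: "hamiltonian_field_cotangent E (section_function E \<tau> h) X"
    and Y: "hamiltonian_field_dual_jet E \<tau> h Y"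
    and z: "z \<in> carrier T" and ia: "i \<in> charts_at T z"
  shows "krylov_distribution n RT X z i =
    tangent_map J T h (rho E \<tau> z) i ` krylov_distribution n RJ Y (rho E \<tau> z) i"
proof -
  let ?x = "rho E \<tau> z"
  let ?D = "tangent_map J T h ?x i"
  have i: "i \<in> charts E" and zi: "z \<in> cdom T i" using ia by (simp_all add: charts_at_iff)
  have VX: "vector_field T X" using X by (simp add: hamiltonian_field_cotangent_def)
  have VY: "vector_field J Y" using Y by (simp add: hamiltonian_field_dual_jet_def)
  have "tangent_map T J (rho E \<tau>) y j (X y j) = Y (rho E \<tau> y) j"
    if "y \<in> carrier T" "j \<in> charts_at T y" for y j
    using that hamiltonian_field_eq[OF X Y, of j y]
    by (simp add: charts_at_iff tangent_map_rho dual_proj_tangent_section)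
  then have "related T J (rho E \<tau>) X Y" by (simp add: related_def)
  note rel = complete_lift_powers_related[OF RT RJ VX VY this, THEN conjunct2]
  have "((tensor_vec RT ^^ k) X) z i = ?D (((tensor_vec RJ ^^ k) Y) ?x i)" for k
  proof -
    let ?v = "((tensor_vec RT ^^ k) X) z i"
    have p: "dual_proj ?v = ((tensor_vec RJ ^^ k) Y) ?x i"
      using rel[of k] z ia unfolding related_def tangent_map_rho[OF i zi, symmetric] by blast
    \<comment> \<open>With \<open>?v\<close> as test vector, the equation for \<open>X\<close>
      converts isotropy into vanishing of the differential of the section function at
      \<open>?v\<close>, which fixes the \<open>p0\<close> component of \<open>?v\<close>.\<close>
    have "canonical_symplectic E z i (X z i) ?v = - (?v \<bullet> differential T (section_function E \<tau> h) z i)"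
      using X z ia unfolding hamiltonian_field_cotangent_def by blast
    moreover have "canonical_symplectic E z i (X z i) ?v = 0"
      using complete_lift_power_isotropic[OF atlas RT VX z ia, of k]
        ext_deriv_antisym[of T canonical_form z i "X z i" ?v]
      by (simp add: canonical_symplectic_def)
    ultimately have "fst (snd ?v) = fst (snd (?D (dual_proj ?v)))"
      by (simp add: inner_differential_section_function[OF i zi])
    moreover have "dual_proj (?D (dual_proj ?v)) = dual_proj ?v"
      using zi by (simp add: dual_proj_tangent_section[OF i])
    ultimately have "?v = ?D (dual_proj ?v)" by (simp add: dual_proj_def prod_eq_iff)
    then show ?thesis by (simp only: p)
  qed
  then have "{((tensor_vec RT ^^ k) X) z i |k. k \<le> n} = ?D ` {((tensor_vec RJ ^^ k) Y) ?x i |k. k \<le> n}"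
    by auto
  moreover have "linear ?D"
    using has_derivative_linear[OF has_derivative_section[OF i, of ?x]] zi by simp
  ultimately show ?thesis
    unfolding krylov_distribution_def by (simp only: linear_span_image)
qed

section \<open>Transfer of integral manifolds between the two bundles\<close>

text \<open>The distributions are arbitrary apart from the relation \<open>D\<close>, which is the
  form in which \<open>krylov_distribution_eq\<close> supplies it. The integral manifold is lifted
  by \<open>h\<close> and then translated to the level of the given point.\<close>

lemma integrable_cotangent_if_dual_jet:
  fixes DJ DT
  assumes D: "\<And>z i. z \<in> carrier T \<Longrightarrow> i \<in> charts_at T z \<Longrightarrow>
      DT z i = tangent_map J T h (rho E \<tau> z) i ` DJ (rho E \<tau> z) i"
    and int: "integrable_distribution TYPE('k::euclidean_space) J DJ"
  shows "integrable_distribution TYPE('k) T DT"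
  unfolding integrable_distribution_def
proof
  fix z assume z: "z \<in> carrier T"
  then obtain W :: "'k set" and f where W: "open W" "inj_on f W" "rho E \<tau> z \<in> f ` W"
    and f: "smooth_map (euclidean_manifold W) J f"
    and Df: "\<And>w i. w \<in> W \<Longrightarrow> i \<in> charts_at J (f w) \<Longrightarrow>
       inj (frechet_derivative (cmap J i \<circ> f) (at w)) \<and>
       range (frechet_derivative (cmap J i \<circ> f) (at w)) = DJ (f w) i"
    using int rho_in_carrier unfolding integrable_distribution_def by metis
  have fJ: "f w \<in> carrier J" if "w \<in> W" for w
    using f that unfolding smooth_map_euclidean_manifold by blast
  have open_f: "open {w \<in> W. f w \<in> cdom J j}"
    and smooth_f: "smooth_on (cmap J j \<circ> f) {w \<in> W. f w \<in> cdom J j}" if "j \<in> charts E" for j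
    using f that unfolding smooth_map_euclidean_manifold by simp_all
  \<comment> \<open>The level of \<open>z\<close>: with this constant the lift of a manifold through
    the projection of \<open>z\<close> passes through \<open>z\<close> itself.\<close>
  define c where "c = section_function E \<tau> h z"
  define F where "F w = translate c (h (f w))" for w
  \<comment> \<open>The projection recovers \<open>f\<close> from the lift, so \<open>F\<close>
    inherits injectivity.\<close>
  have rho_F: "rho E \<tau> (F w) = f w" if "w \<in> W" for w
    using fJ[OF that] by (simp add: F_def rho_translate rho_section)
  have F_cdom: "F w \<in> cdom T j \<longleftrightarrow> f w \<in> cdom J j" if "w \<in> W" for w j
    using fJ[OF that] by (simp add: F_def section_in_cdom)
  have F_carrier: "F w \<in> carrier T" if "w \<in> W" for w
    using rho_F[OF that] fJ[OF that] rho_in_carrier by metis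
  have sets: "{w \<in> W. F w \<in> cdom T j} = {w \<in> W. f w \<in> cdom J j}" for j
    using F_cdom by blast
  \<comment> \<open>In charts the lift is the expression of the section after that of
    \<open>f\<close>, plus a constant; smoothness and the derivative of \<open>F\<close> are read
    off from this.\<close>
  have F_eq: "(cmap T j \<circ> F) w = (cmap T j \<circ> h \<circ> cinv J j) ((cmap J j \<circ> f) w) + (0, (c, 0))"
    if "j \<in> charts E" "w \<in> {w \<in> W. f w \<in> cdom J j}" for j w
    using that fJ by (simp add: F_def cmap_translate section_in_cdom cinv_cmap_dual_jet_bundle)
  show "\<exists>(W :: 'k set) f. open W \<and> inj_on f W \<and> z \<in> f ` W \<and> smooth_map (euclidean_manifold W) T f \<and>
      (\<forall>w\<in>W. \<forall>i\<in>charts_at T (f w). inj (frechet_derivative (cmap T i \<circ> f) (at w)) \<and>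
        range (frechet_derivative (cmap T i \<circ> f) (at w)) = DT (f w) i)"
  proof (intro exI[of _ W] exI[of _ F] conjI ballI)
    show "open W" by (rule W(1))
    show "inj_on F W"
      using W(2) rho_F unfolding inj_on_def by metis
    obtain w where "w \<in> W" "f w = rho E \<tau> z" using W(3) by (metis imageE)
    moreover from this have "F w = z" by (simp add: F_def c_def translate_section_function[OF z])
    ultimately show "z \<in> F ` W" by blast
    show "smooth_map (euclidean_manifold W) T F"
      unfolding smooth_map_euclidean_manifold sets
    proof (intro conjI ballI)
      show "F ` W \<subseteq> carrier T" using F_carrier by blast
      fix j assume "j \<in> charts T"
      then have j: "j \<in> charts E" by simp
      show "open {w \<in> W. f w \<in> cdom J j}" by (rule open_f[OF j])
      have "smooth_on (\<lambda>w. (cmap T j \<circ> h \<circ> cinv J j) ((cmap J j \<circ> f) w) + (0, (c, 0)))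
          {w \<in> W. f w \<in> cdom J j}"
        by (rule smooth_on_add_const[OF open_f[OF j] smooth_on_compose[OF open_f[OF j] _
                smooth_f[OF j] smooth_on_section[OF j]]])
          (auto intro: cmap_in_cimage)
      then show "smooth_on (cmap T j \<circ> F) {w \<in> W. f w \<in> cdom J j}"
        by (rule smooth_on_transform[OF _ open_f[OF j]]) (rule F_eq[OF j])
    qed
  next
    fix w i assume w: "w \<in> W" and "i \<in> charts_at T (F w)"
    then have i: "i \<in> charts E" "F w \<in> cdom T i" by (simp_all add: charts_at_iff)
    then have fw: "f w \<in> cdom J i" using F_cdom w by blast
    let ?D = "tangent_map J T h (f w) i"
    let ?d = "frechet_derivative (cmap J i \<circ> f) (at w)"
    have f': "(cmap J i \<circ> f has_derivative ?d) (at w)"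
      unfolding frechet_derivative_works[symmetric]
      by (rule smooth_on_imp_differentiable[OF smooth_f[OF i(1)]]) (use w fw in simp)
    have h': "(cmap T i \<circ> h \<circ> cinv J i has_derivative ?D) (at ((cmap J i \<circ> f) w))"
      using has_derivative_section[OF i(1) fw] by simp
    have "((\<lambda>u. (cmap T i \<circ> h \<circ> cinv J i) ((cmap J i \<circ> f) u) + (0, (c, 0)))
        has_derivative (\<lambda>v. ?D (?d v))) (at w)"
      by (rule has_derivative_add_const[OF has_derivative_compose[OF f' h']])
    then have "(cmap T i \<circ> F has_derivative (\<lambda>v. ?D (?d v))) (at w)"
      by (rule has_derivative_transform_within_open[OF _ open_f[OF i(1)]])
        (use w fw F_eq[OF i(1)] in auto)
    then have DF: "frechet_derivative (cmap T i \<circ> F) (at w) = ?D \<circ> ?d"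
      by (simp add: frechet_derivative_at[symmetric] comp_def)
    have d: "inj ?d" "range ?d = DJ (f w) i"
      using Df[OF w] i fw by (simp_all add: charts_at_iff)
    have "inj ?D"
      using dual_proj_tangent_section[OF i(1) fw] by (metis injI)
    then show "inj (frechet_derivative (cmap T i \<circ> F) (at w))"
      unfolding DF using d(1) by (rule inj_compose)
    have "DT (F w) i = ?D ` DJ (f w) i"
      using D[OF F_carrier[OF w], of i] i by (simp add: charts_at_iff rho_F[OF w])
    then show "range (frechet_derivative (cmap T i \<circ> F) (at w)) = DT (F w) i"
      by (simp only: DF d(2) image_comp[symmetric])
  qed
qed

text \<open>The obstacle to projecting an integral manifold is that \<rho> identifies points of
  different levels. On a ball of parameters the section function is constant, and \<rho> is
  injective on each of its level sets.\<close>

lemma integrable_dual_jet_if_cotangent: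
  fixes DJ DT
  assumes D: "\<And>z i. z \<in> carrier T \<Longrightarrow> i \<in> charts_at T z \<Longrightarrow>
      DT z i = tangent_map J T h (rho E \<tau> z) i ` DJ (rho E \<tau> z) i"
    and int: "integrable_distribution TYPE('k::euclidean_space) T DT"
  shows "integrable_distribution TYPE('k) J DJ"
  unfolding integrable_distribution_def
proof
  fix x assume x: "x \<in> carrier J"
  let ?H = "section_function E \<tau> h"
  obtain W :: "'k set" and f where W: "open W" "inj_on f W" "h x \<in> f ` W"
    and f: "smooth_map (euclidean_manifold W) T f"
    and Df: "\<And>w i. w \<in> W \<Longrightarrow> i \<in> charts_at T (f w) \<Longrightarrow>
       inj (frechet_derivative (cmap T i \<circ> f) (at w)) \<and>
       range (frechet_derivative (cmap T i \<circ> f) (at w)) = DT (f w) i"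
    using int section_in_carrier[OF x] unfolding integrable_distribution_def by metis
  have fT: "f w \<in> carrier T" if "w \<in> W" for w
    using f that unfolding smooth_map_euclidean_manifold by blast
  have open_f: "open {w \<in> W. f w \<in> cdom T j}"
    and smooth_f: "smooth_on (cmap T j \<circ> f) {w \<in> W. f w \<in> cdom T j}" if "j \<in> charts E" for j
    using f that unfolding smooth_map_euclidean_manifold by simp_all
  have der_f: "(cmap T i \<circ> f has_derivative frechet_derivative (cmap T i \<circ> f) (at w)) (at w)"
    if "w \<in> W" "i \<in> charts_at T (f w)" for w i
    unfolding frechet_derivative_works[symmetric]
    by (rule smooth_on_imp_differentiable[OF smooth_f]) (use that in \<open>auto simp: charts_at_iff\<close>)
  \<comment> \<open>Tangent vectors of the integral manifold lie in \<open>DT\<close>, hence in the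
    image of the derivative of \<open>h\<close>, where \<open>dual_proj\<close> can be
    undone.\<close>
  have tangent: "frechet_derivative (cmap T i \<circ> f) (at w) v =
      tangent_map J T h (rho E \<tau> (f w)) i (dual_proj (frechet_derivative (cmap T i \<circ> f) (at w) v))"
    if "w \<in> W" "i \<in> charts_at T (f w)" for w i v
  proof -
    have "frechet_derivative (cmap T i \<circ> f) (at w) v \<in> DT (f w) i"
      using Df[OF that] by blast
    then show ?thesis
      using D[OF fT[OF that(1)] that(2)] that(2)
      by (auto simp: charts_at_iff dual_proj_tangent_section)
  qed
  obtain a where a: "a \<in> W" "f a = h x" using W(3) by (metis imageE)
  \<comment> \<open>\<open>W\<close> may be disconnected, so it is shrunk to a ball around the
    parameter of \<open>h x\<close>; convexity then yields constancy from a vanishing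
    derivative.\<close>
  obtain r where r: "r > 0" "ball a r \<subseteq> W" using W(1) a(1) openE by blast
  let ?B = "ball a r"
  \<comment> \<open>By \<open>tangent\<close>, the \<open>p0\<close> component of a tangent vector
    is the one prescribed by the derivative of \<open>h\<close>, so the two terms of the derivative
    of the section function cancel.\<close>
  have "(?H \<circ> f has_derivative (\<lambda>v. 0)) (at w)" if w: "w \<in> W" for w
  proof -
    obtain i where ia: "i \<in> charts_at T (f w)" using charts_at_nonempty[OF fT[OF w]] by blast
    then have i: "i \<in> charts E" "f w \<in> cdom T i" by (simp_all add: charts_at_iff)
    have "(?H \<circ> cinv T i has_derivative
        (\<lambda>u. fst (snd u) - fst (snd (tangent_map J T h (rho E \<tau> (f w)) i (dual_proj u)))))
        (at ((cmap T i \<circ> f) w))"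
      using has_derivative_section_function[OF i] by simp
    from has_derivative_compose[OF der_f[OF w ia] this]
    have "((\<lambda>u. (?H \<circ> cinv T i) ((cmap T i \<circ> f) u)) has_derivative (\<lambda>v. 0)) (at w)"
      by (simp add: tangent[OF w ia, symmetric])
    then show ?thesis
      by (rule has_derivative_transform_within_open[OF _ open_f[OF i(1)]])
        (use w i in \<open>auto simp: cinv_cmap_cotangent_bundle[OF atlas]\<close>)
  qed
  then have "\<exists>c. \<forall>w\<in>?B. (?H \<circ> f) w = c"
    using r(2) by (intro has_derivative_zero_constant convex_ball) (blast intro: has_derivative_at_withinI)
  then have "?H (f w) = ?H (h x)" if "w \<in> ?B" for w
    using that r(1) a(2) by (metis centre_in_ball comp_apply)
  \<comment> \<open>Starting the integral manifold at \<open>h x\<close> selects the zero level.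
    Hence no translation remains in \<open>f_eq\<close>, and \<open>h\<close> inverts the projection
    along the ball.\<close>
  moreover have "?H (h x) = 0"
  proof -
    obtain i where i: "i \<in> charts E" "x \<in> cdom J i" using x by (auto simp: carrier_def)
    then show ?thesis
      using section_function_eq[OF i(1), of "h x"] x by (simp add: section_in_cdom rho_section)
  qed
  ultimately have f_eq: "f w = h (rho E \<tau> (f w))" if "w \<in> ?B" for w
    using translate_section_function[OF fT, of w] that r(2) by auto
  define g where "g w = rho E \<tau> (f w)" for w
  have sets: "{w \<in> ?B. g w \<in> cdom J j} = ?B \<inter> {w \<in> W. f w \<in> cdom T j}" for j
    using r(2) by (auto simp: g_def)
  have g_eq: "(cmap J j \<circ> g) w = dual_proj ((cmap T j \<circ> f) w)"
    if "j \<in> charts E" "w \<in> ?B \<inter> {w \<in> W. f w \<in> cdom T j}" for j w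
    using that by (simp add: g_def cmap_rho)
  have open_g: "open (?B \<inter> {w \<in> W. f w \<in> cdom T j})" if "j \<in> charts E" for j
    by (intro open_Int open_ball open_f[OF that])
  show "\<exists>(W :: 'k set) f. open W \<and> inj_on f W \<and> x \<in> f ` W \<and> smooth_map (euclidean_manifold W) J f \<and>
      (\<forall>w\<in>W. \<forall>i\<in>charts_at J (f w). inj (frechet_derivative (cmap J i \<circ> f) (at w)) \<and>
        range (frechet_derivative (cmap J i \<circ> f) (at w)) = DJ (f w) i)"
  proof (intro exI[of _ ?B] exI[of _ g] conjI ballI)
    show "open ?B" by (rule open_ball)
    show "inj_on g ?B"
    proof (rule inj_onI)
      fix u v assume uv: "u \<in> ?B" "v \<in> ?B" "g u = g v"
      then have "f u = f v" using f_eq[of u] f_eq[of v] by (simp add: g_def)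
      then show "u = v" using uv W(2) r(2) by (meson inj_onD subsetD)
    qed
    have "g a = x" by (simp add: g_def a(2) rho_section[OF x])
    then show "x \<in> g ` ?B" using r(1) by force
    show "smooth_map (euclidean_manifold ?B) J g"
      unfolding smooth_map_euclidean_manifold sets
    proof (intro conjI ballI)
      show "g ` ?B \<subseteq> carrier J" using fT r(2) by (auto simp: g_def)
      fix j assume "j \<in> charts J"
      then have j: "j \<in> charts E" by simp
      show "open (?B \<inter> {w \<in> W. f w \<in> cdom T j})" by (rule open_g[OF j])
      have "smooth_on (cmap T j \<circ> f) (?B \<inter> {w \<in> W. f w \<in> cdom T j})"
        by (rule smooth_on_subset[OF smooth_f[OF j]]) blast
      from smooth_on_bounded_linear[OF open_g[OF j] bounded_linear_dual_proj this]
      show "smooth_on (cmap J j \<circ> g) (?B \<inter> {w \<in> W. f w \<in> cdom T j})"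
        by (rule smooth_on_transform[OF _ open_g[OF j] g_eq[OF j]])
    qed
  next
    fix w i assume w: "w \<in> ?B" and "i \<in> charts_at J (g w)"
    then have ia: "i \<in> charts_at T (f w)" by (simp add: g_def)
    then have i: "i \<in> charts E" "f w \<in> cdom T i" by (simp_all add: charts_at_iff)
    have wW: "w \<in> W" using w r(2) by blast
    let ?d = "frechet_derivative (cmap T i \<circ> f) (at w)"
    have "((\<lambda>u. dual_proj ((cmap T i \<circ> f) u)) has_derivative (\<lambda>v. dual_proj (?d v))) (at w)"
      by (rule bounded_linear.has_derivative[OF bounded_linear_dual_proj der_f[OF wW ia]])
    then have "(cmap J i \<circ> g has_derivative (\<lambda>v. dual_proj (?d v))) (at w)"
      by (rule has_derivative_transform_within_open[OF _ open_g[OF i(1)]])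
        (use w wW i g_eq[OF i(1)] in auto)
    then have Dg: "frechet_derivative (cmap J i \<circ> g) (at w) = dual_proj \<circ> ?d"
      by (simp add: frechet_derivative_at[symmetric] comp_def)
    have d: "inj ?d" "range ?d = DT (f w) i"
      using Df[OF wW ia] by simp_all
    \<comment> \<open>By \<open>tangent\<close>, a tangent vector of \<open>f\<close> is determined
      by its projection, so composing with \<open>dual_proj\<close> keeps the derivative
      injective.\<close>
    show "inj (frechet_derivative (cmap J i \<circ> g) (at w))"
      unfolding Dg
    proof (rule injI)
      fix u v assume "(dual_proj \<circ> ?d) u = (dual_proj \<circ> ?d) v"
      then have "tangent_map J T h (rho E \<tau> (f w)) i (dual_proj (?d u)) =
          tangent_map J T h (rho E \<tau> (f w)) i (dual_proj (?d v))" by simp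
      then have "?d u = ?d v" by (simp only: tangent[OF wW ia, symmetric])
      then show "u = v" by (rule injD[OF d(1)])
    qed
    have "dual_proj ` DT (f w) i = DJ (g w) i"
      using i by (simp add: D[OF fT[OF wW] ia] image_image dual_proj_tangent_section g_def)
    then show "range (frechet_derivative (cmap J i \<circ> g) (at w)) = DJ (g w) i"
      by (simp only: Dg d(2) image_comp[symmetric])
  qed
qed

end

theorem theorem5:
  fixes E :: "('i, 'e, real \<times> (real ^ 'n)) manifold"
    and \<tau> :: "'e \<Rightarrow> real"
    and R :: "'e \<Rightarrow> 'i \<Rightarrow> real \<times> (real ^ 'n) \<Rightarrow> real \<times> (real ^ 'n)"
  assumes "bundle_over_real E \<tau>"
    and "tensor11 E R"
    and "\<forall>e\<in>carrier E. \<forall>i\<in>charts_at E e. tensor_covec E R e (differential E \<tau> e) i = 0"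
    and "nijenhuis_torsion_free E R"
    and "diagonalizable_distinct E R"
    and "complete_lift_cotangent E R RT"
    and "complete_lift_dual_jet E \<tau> RT RJ"
    and "hamiltonian_section E \<tau> h"
    and "hamiltonian_field_cotangent E (section_function E \<tau> h) XH"
    and "hamiltonian_field_dual_jet E \<tau> h Xh"
    and "\<forall>z\<in>carrier (cotangent_bundle E). \<forall>i\<in>charts_at (cotangent_bundle E) z.
           inj_on (\<lambda>k. ((tensor_vec RT ^^ k) XH) z i) {..CARD('n)} \<and>
           independent ((\<lambda>k. ((tensor_vec RT ^^ k) XH) z i) ` {..CARD('n)})"
  shows "integrable_distribution TYPE(real \<times> (real ^ 'n)) (dual_jet_bundle E \<tau>)
           (krylov_distribution CARD('n) RJ Xh) \<longleftrightarrow>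
         integrable_distribution TYPE(real \<times> (real ^ 'n)) (cotangent_bundle E)
           (krylov_distribution CARD('n) RT XH)"
proof -
  interpret hamiltonian_atlas E \<tau> h
    using assms(1,8) by unfold_locales (auto simp: bundle_over_real_def smooth_manifold_def)
  \<comment> \<open>This is hypothesis \<open>D\<close> of both transfer lemmas. The parameter space
    has dimension n + 1, the number of linearly independent powers.\<close>
  note eq = krylov_distribution_eq[OF assms(6,7,9,10)]
  show ?thesis
  proof
    assume "integrable_distribution TYPE(real \<times> (real ^ 'n)) J (krylov_distribution CARD('n) RJ Xh)"
    then show "integrable_distribution TYPE(real \<times> (real ^ 'n)) T (krylov_distribution CARD('n) RT XH)"
      by (rule integrable_cotangent_if_dual_jet[rotated]) (rule eq)
  next
    assume "integrable_distribution TYPE(real \<times> (real ^ 'n)) T (krylov_distribution CARD('n) RT XH)"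
    then show "integrable_distribution TYPE(real \<times> (real ^ 'n)) J (krylov_distribution CARD('n) RJ Xh)"
      by (rule integrable_dual_jet_if_cotangent[rotated]) (rule eq)
  qed
qed

end
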